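(* Let $y_h\in\mathcal Y_{\rm qc}$ with $y_h'(x)>0$. Then $$\big\|\mathcal E_{\rm a}'(J_{\mathcal U_{\rm qc}}y_h)[\cdot]-\mathcal E_{\rm qc}'(y_h)[J_{\mathcal U}\,\cdot\,]\big\|_{\mathcal U^{-1,2}}\ \le\ \Big\{\sum_{k\in\mathcal K_c}(\eta^e_k)^2\Big\}^{1/2}=:\mathscr E_{\rm store}(y_h),$$ where, with the quantities $[[\phi']]_{\ell_k+j}$ defined in the context, $$\eta_k^e=\Big(\tfrac12\varepsilon\sum_{j=0}^2[[\phi']]_{\ell_{k-1}+j}^2+\tfrac12\varepsilon\sum_{j=0}^2[[\phi']]_{\ell_k+j}^2\Big)^{1/2}\quad\text{if }k\in\mathcal K_c',$$ $$\eta_k^e=\Big(\varepsilon\sum_{j=0}^2[[\phi']]_{\ell_{La_i}+j}^2+\tfrac12\varepsilon\sum_{j=0}^2[[\phi']]_{\ell_{k-1}+j}^2\Big)^{1/2}$$ if $k=La_i$ for some $i\in\{1,\dots,M\}$ (i.e. $T_k$ is adjacent to and to the left of an atomistic region), and $$\eta_k^e=\Big(\varepsilon\sum_{j=0}^2[[\phi']]_{\ell_{Ra_i}+j}^2+\tfrac12\varepsilon\sum_{j=0}^2[[\phi']]_{\ell_k+j}^2\Big)^{1/2}$$ if $k-1=Ra_i$ for some $i\in\{1,\dots,M\}$ (i.e. $T_k$ is adjacent to and to the right of an atomistic region).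
   Context: **Lattice.** $N\in\mathbb N$, $\varepsilon=1/N$; $\mathcal T^\varepsilon$ is the partition of $\mathbb R$ into the intervals $[(\ell-1)\varepsilon,\ell\varepsilon]$, $\ell\in\mathbb Z$. $\mathcal P_1(\mathcal T)$ denotes the functions that are affine on each element of $\mathcal T$. $F>0$ is fixed. $\phi\in C^3((0,\infty))$ is a Lennard-Jones type potential: for some $r_*>0$ it is convex on $(0,r_* )$ and concave on $(r_*,\infty)$. **Regions and mesh.** $\mathbb R$ is decomposed into an atomistic region $\Omega_{\rm a}$, a union of open intervals, and a continuum region $\Omega_c$, a union of closed intervals, with $\Omega_{\rm a}\cup\Omega_c=\mathbb R$; both are 1-periodic, and there is $\delta>2\varepsilon$ with $(0,\delta)\cup(1-\delta,1)\subset\Omega_c$. $\mathcal T^h$ is a partition of $\mathbb R$ with nodes $x^h_{k-1}<x^h_k$ and elements $T_k=[x^h_{k-1},x^h_k]$, $k\in\mathbb Z$; it is periodic, $x^h_{k+K}=x^h_k+1$, and $x^h_1$, $x^h_K$ are the leftmost and rightmost nodes in $[0,1]$. Every lattice point $\ell\varepsilon\in\Omega_{\rm a}$ is a node; every point of $\partial\Omega_c$ is a node, so each element lies in only one of the two regions; $|T_k|\ge2\varepsilon$ if $T_k\subset\Omega_c$. Set $\ell_k=\max\{\ell:\ell\varepsilon\le x_k^h\}$ and $\theta_k=(x^h_k-\ell_k\varepsilon)/\varepsilon$. **Index sets.** $\mathcal K_c$ is the set of $k\in\{1,\dots,K\}$ with $T_k\cap[0,1]\ne\emptyset$, $T_k\cap(1,\infty)=\emptyset$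 and $T_k\subset\Omega_c$. $\Omega_{\rm a}\cap[0,1]$ is the union of $M$ disjoint subregions $\Omega_{\rm a}^i$; the node at the left interface of $\Omega^i_{\rm a}$ is $x^h_{La_i}$ and the node at its right interface is $x^h_{Ra_i}$. $\mathcal K'_c\subset\mathcal K_c$ is the set of indices of continuum elements not adjacent to an atomistic region, i.e. $k\ne La_i$ and $k-1\ne Ra_i$ for all $i$. **Spaces.** $\mathcal U=\{u\in\mathcal P_1(\mathcal T^\varepsilon)\cap C^0(\mathbb R):u(x+1)=u(x),\ \int_0^1u\,dx=0\}$; $\mathcal U_{\rm qc}$ is defined in the same way with $\mathcal T^h$ in place of $\mathcal T^\varepsilon$; $\mathcal Y_{\rm qc}=\{Fx+u:u\in\mathcal U_{\rm qc}\}$. For a functional $T$ on $\mathcal U$, $\|T\|_{\mathcal U^{-1,2}}=\sup\{T[v]:v\in\mathcal U,\ \|v'\|_{L^2[0,1]}=1\}$. $I_\varepsilon$, $I_h$ are the continuous piecewise affine nodal interpolation operators on $\mathcal T^\varepsilon$, $\mathcal T^h$. For $v\in\mathcal U$, $J_{\mathcal U}v=I_hv-\frac12\sum_{k=1}^K(x^h_{k+1}-x^h_{k-1})v(x^h_k)$. For $y_h=Fx+u_h\in\mathcal Y_{\rm qc}$, $J_{\mathcal U_{\rm qc}}y_h=Fx+I_\varepsilon u_h-\varepsilon\sum_{\ell=1}^Nu_h(\ell\varepsilon)$. **Energies.** Bonds: $\mathcal B=\{(i\varepsilon,(i+r)\varepsilon):r=1,2,\ i=0,\dots,N-1\}$,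 with $r_b=r$ for $b=(i\varepsilon,(i+r)\varepsilon)$. For an open interval $\omega=(L_\omega,R_\omega)$, $D_\omega y=(y(R_\omega)-y(L_\omega))/|\omega|$. The stored energies are $\mathcal E_{\rm a}(y)=\varepsilon\sum_{b\in\mathcal B}\phi(r_bD_by)$ and $\mathcal E_{\rm qc}(y)=\sum_{b\in\mathcal B}\big[\frac{|b\cap\Omega_{\rm a}|}{r_b}\phi(r_bD_{b\cap\Omega_{\rm a}}y)+\frac1{r_b}\int_{b\cap\Omega_c}\phi(r_by'(x))\,dx\big]$ (the first term being $0$ if $b\cap\Omega_{\rm a}=\emptyset$), with first variations $$\mathcal E_{\rm a}'(y)[v]=\varepsilon\sum_{b\in\mathcal B}\phi'(r_bD_by)\,r_bD_bv,$$ $$\mathcal E_{\rm qc}'(y)[w]=\sum_{b\in\mathcal B}|b\cap\Omega_{\rm a}|\,\phi'(r_bD_{b\cap\Omega_{\rm a}}y)\,D_{b\cap\Omega_{\rm a}}w+\sum_{b\in\mathcal B}\frac1{r_b}\int_{b\cap\Omega_c}\phi'(r_by')\,r_bw'\,dx.$$ **The quantities $[[\phi']]$.** Write $G_k=y_h'|_{T_k}$ and $\theta=\theta_k$. To a node $x_k^h$ are attached three quantities $[[\phi']]_{\ell_k},[[\phi']]_{\ell_k+1},[[\phi']]_{\ell_k+2}$. (i) $k=La_i$: $[[\phi']]_{\ell_k}=\phi'((1-\theta)G_{k+1}+(1+\theta)G_k)-\phi'(2G_k)$; $[[\phi']]_{\ell_k+1}=\big[\phi'((1-\theta)G_{k+1}+\theta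 G_k)-(1-\theta)\phi'(G_{k+1})-\theta\phi'(G_k)\big]+\big[(1-\theta)\phi'\big(\tfrac{2}{2-\theta}G_{k+2}+\tfrac{2(1-\theta)}{2-\theta}G_{k+1}\big)+\theta\phi'(2G_k)-\phi'(G_{k+2}+(1-\theta)G_{k+1}+\theta G_k)\big]+\big[(1-\theta)\phi'(2G_{k+1})+\theta\phi'(2G_k)-\phi'((1-\theta)G_{k+1}+(1+\theta)G_k)\big]$; $[[\phi']]_{\ell_k+2}=\phi'\big(\tfrac{2(1-\theta)}{2-\theta}G_{k+1}+\tfrac{2}{2-\theta}G_{k+2}\big)-\phi'(G_{k+2}+(1-\theta)G_{k+1}+\theta G_k)$. (ii) $k=Ra_i$: $[[\phi']]_{\ell_k}=\phi'((1-\theta)G_{k+1}+\theta G_k+G_{k-1})-\phi'\big(\tfrac{2\theta}{1+\theta}G_k+\tfrac{2}{1+\theta}G_{k-1}\big)$; $[[\phi']]_{\ell_k+1}=\big[\theta\phi'(G_k)+(1-\theta)\phi'(G_{k+1})-\phi'((1-\theta)G_{k+1}+\theta G_k)\big]+\big[\theta\phi'\big(\tfrac{2\theta}{1+\theta}G_k+\tfrac{2}{1+\theta}G_{k-1}\big)+(1-\theta)\phi'(2G_{k+1})-\phi'((1-\theta)G_{k+1}+\theta G_k+G_{k-1})\big]+\big[(1-\theta)\phi'(2G_{k+1})+\theta\phi'(2G_k)-\phi'((2-\theta)G_{k+1}+\theta G_k)\big]$; $[[\phi']]_{\ell_k+2}=\phi'(2G_{k+1})-\phi'((2-\theta)G_{k+1}+\theta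 G_k)$. (iii) $x_k^h$ a node in the interior of $\Omega_c$: $[[\phi']]_{\ell_k}=\phi'(2G_k)-\phi'((1-\theta)G_{k+1}+(1+\theta)G_k)$; $[[\phi']]_{\ell_k+1}=\big[(1-\theta)\phi'(G_{k+1})+\theta\phi'(G_k)-\phi'((1-\theta)G_{k+1}+\theta G_k)\big]+\big[2(1-\theta)\phi'(2G_{k+1})+2\theta\phi'(2G_k)-\phi'((2-\theta)G_{k+1}+\theta G_k)-\phi'((1-\theta)G_{k+1}+(1+\theta)G_k)\big]$; $[[\phi']]_{\ell_k+2}=\phi'(2G_{k+1})-\phi'((2-\theta)G_{k+1}+\theta G_k)$.
   Formalization: Corrected: first bracket of [[φ']]_{ℓ_k+1} in (i) has opposite sign; in (ii) at θ=0, G_{k-1} becomes G_k. Added: nodes in Ω_a are lattice points; each continuum element and each Ω_a^i contains two whole lattice cells. If T_k has Ω_a on both sides, both end nodes get full weight. *)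

theory Defs
  imports "HOL-Analysis.Analysis"
begin

section \<open>Potential, piecewise affine spaces, interpolation\<close>

definition C3_on_pos :: "(real \<Rightarrow> real) \<Rightarrow> bool" where
  "C3_on_pos \<phi> \<longleftrightarrow>
     (\<forall>m<3. (deriv ^^ m) \<phi> differentiable_on {0<..}) \<and> continuous_on {0<..} ((deriv ^^ 3) \<phi>)"

definition LJ_potential :: "(real \<Rightarrow> real) \<Rightarrow> bool" where
  "LJ_potential \<phi> \<longleftrightarrow>
     C3_on_pos \<phi> \<and> (\<exists>r>0. convex_on {0<..<r} \<phi> \<and> concave_on {r<..} \<phi>)"

text \<open>A partition of the real line is given by its nodes, a strictly increasing function on the
  integers that is unbounded in both directions; its elements are the intervals between
  consecutive nodes.\<close>

abbreviation elem :: "(int \<Rightarrow> real) \<Rightarrow> int \<Rightarrow> real set" where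
  "elem z k \<equiv> {z (k - 1)..z k}"

definition lattice :: "nat \<Rightarrow> int \<Rightarrow> real" where
  "lattice N l = of_int l / real N"

definition P1 :: "(int \<Rightarrow> real) \<Rightarrow> (real \<Rightarrow> real) set" where
  "P1 z = {u. \<forall>k. \<exists>a b. \<forall>t\<in>elem z k. u t = a + b * t}"

definition periodic_P1 :: "(int \<Rightarrow> real) \<Rightarrow> (real \<Rightarrow> real) set" where
  "periodic_P1 z =
     {u \<in> P1 z. continuous_on UNIV u \<and> (\<forall>t. u (t + 1) = u t) \<and> integral {0..1} u = 0}"

definition space_U :: "nat \<Rightarrow> (real \<Rightarrow> real) set" where
  "space_U N = periodic_P1 (lattice N)"

definition space_Uqc :: "(int \<Rightarrow> real) \<Rightarrow> (real \<Rightarrow> real) set" where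
  "space_Uqc x = periodic_P1 x"

definition space_Yqc :: "real \<Rightarrow> (int \<Rightarrow> real) \<Rightarrow> (real \<Rightarrow> real) set" where
  "space_Yqc F x = {\<lambda>t. F * t + u t | u. u \<in> space_Uqc x}"

definition interp :: "(int \<Rightarrow> real) \<Rightarrow> (real \<Rightarrow> real) \<Rightarrow> real \<Rightarrow> real" where
  "interp z v t =
     (let k = (THE k. z (k - 1) \<le> t \<and> t < z k)
      in v (z (k - 1)) + (v (z k) - v (z (k - 1))) / (z k - z (k - 1)) * (t - z (k - 1)))"

definition J_U :: "(int \<Rightarrow> real) \<Rightarrow> nat \<Rightarrow> (real \<Rightarrow> real) \<Rightarrow> real \<Rightarrow> real" where
  "J_U x K v t =
     interp x v t - (1/2) * (\<Sum>k\<in>{1..int K}. (x (k + 1) - x (k - 1)) * v (x k))"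

definition J_Uqc :: "nat \<Rightarrow> real \<Rightarrow> (real \<Rightarrow> real) \<Rightarrow> real \<Rightarrow> real" where
  "J_Uqc N F y t =
     (let u = (\<lambda>s. y s - F * s)
      in F * t + interp (lattice N) u t - (1 / real N) * (\<Sum>l\<in>{1..int N}. u (lattice N l)))"

definition L2_norm_01 :: "(real \<Rightarrow> real) \<Rightarrow> real" where
  "L2_norm_01 f = sqrt (integral {0..1} (\<lambda>t. (f t)\<^sup>2))"

text \<open>The value is taken in the extended reals, so that an upper bound for it is meaningful
  without a separate proof that the set is bounded.\<close>

definition dual_norm :: "nat \<Rightarrow> ((real \<Rightarrow> real) \<Rightarrow> real) \<Rightarrow> ereal" where
  "dual_norm N T = (SUP v\<in>{v \<in> space_U N. L2_norm_01 (deriv v) = 1}. ereal (T v))"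


section \<open>Regions and mesh\<close>

text \<open>\<open>Oa\<close> and \<open>Oc\<close> are the atomistic and the continuum region, \<open>x\<close> is the node function of the
  mesh; \<open>La i\<close> and \<open>Ra i\<close> are the indices of the nodes at the left and right interface of the
  \<open>i\<close>-th atomistic subregion.

  The last two assumptions (\<open>two_cells_c\<close>, \<open>two_cells_a\<close>) make sure that a lattice index at which
  nonzero quantities \<open>jump\<close> (below) are attached belongs to one node only.  The first of them
  implies \<open>length_c\<close>, and is equivalent to it for an element whose end points are lattice
  points.\<close>

locale qc_mesh =
  fixes N :: nat and Oa Oc :: "real set" and x :: "int \<Rightarrow> real" and K :: nat
    and M :: nat and La Ra :: "nat \<Rightarrow> int"
  assumes N_pos: "N > 0"
    and decomposition: "Oa \<union> Oc = UNIV" "Oa \<inter> Oc = {}"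
    and open_a: "open Oa" and closed_c: "closed Oc"
    and periodic_regions: "\<And>t. t + 1 \<in> Oa \<longleftrightarrow> t \<in> Oa" "\<And>t. t + 1 \<in> Oc \<longleftrightarrow> t \<in> Oc"
    and boundary_layer: "\<exists>\<delta>. \<delta> > 2 / real N \<and> {0<..<\<delta>} \<union> {1 - \<delta><..<1} \<subseteq> Oc"
    and strict_mono_x: "strict_mono x"
    and periodic_x: "\<And>k. x (k + int K) = x k + 1"
    and leftmost: "0 \<le> x 1" "x 0 < 0"
    and rightmost: "x (int K) \<le> 1" "1 < x (int K + 1)"
    and lattice_point_node: "\<And>l. lattice N l \<in> Oa \<Longrightarrow> lattice N l \<in> range x"
    and node_lattice_point: "\<And>k. x k \<in> Oa \<Longrightarrow> x k \<in> range (lattice N)"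
    and frontier_node: "frontier Oc \<subseteq> range x"
    and length_c: "\<And>k. elem x k \<subseteq> Oc \<Longrightarrow> x k - x (k - 1) \<ge> 2 / real N"
    and La_less_Ra: "\<And>i. i \<in> {1..M} \<Longrightarrow> La i < Ra i"
    and subregions: "Oa \<inter> {0..1} = (\<Union>i\<in>{1..M}. {x (La i)<..<x (Ra i)})"
    and separated: "\<And>i j. \<lbrakk>i \<in> {1..M}; j \<in> {1..M}; i \<noteq> j\<rbrakk> \<Longrightarrow>
          {x (La i)..x (Ra i)} \<inter> {x (La j)..x (Ra j)} = {}"
    and two_cells_c: "\<And>k. elem x k \<subseteq> Oc \<Longrightarrow>
          \<exists>l. x (k - 1) \<le> lattice N l \<and> lattice N (l + 2) \<le> x k"
    and two_cells_a: "\<And>i. i \<in> {1..M} \<Longrightarrow>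
          \<exists>l. x (La i) \<le> lattice N l \<and> lattice N (l + 2) \<le> x (Ra i)"

definition index_c :: "(int \<Rightarrow> real) \<Rightarrow> nat \<Rightarrow> real set \<Rightarrow> int set" where
  "index_c x K Oc = {k \<in> {1..int K}. elem x k \<inter> {0..1} \<noteq> {} \<and> elem x k \<inter> {1<..} = {} \<and> elem x k \<subseteq> Oc}"

text \<open>Whether node \<open>k\<close> is a left (for \<open>I = La\<close>) or right (for \<open>I = Ra\<close>) interface node, with indices
  read modulo \<open>K\<close>: the left node of the element with index 1 has index 0, and it is an
  interface node if its periodic copy with index \<open>K\<close> is one.\<close>

definition is_interface :: "nat \<Rightarrow> nat \<Rightarrow> (nat \<Rightarrow> int) \<Rightarrow> int \<Rightarrow> bool" where
  "is_interface K M I k \<longleftrightarrow> (\<exists>i\<in>{1..M}. \<exists>n. k = I i + n * int K)"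


section \<open>First variations of the stored energies\<close>

definition bond :: "nat \<Rightarrow> nat \<Rightarrow> nat \<Rightarrow> real set" where
  "bond N i r = {real i / real N<..<real (i + r) / real N}"

text \<open>The difference quotient of \<open>y\<close> over the open interval \<open>w\<close>; its value on the empty set does
  not matter, as it only occurs multiplied by the length of \<open>w\<close>.\<close>

definition diffq :: "real set \<Rightarrow> (real \<Rightarrow> real) \<Rightarrow> real" where
  "diffq w y = (y (Sup w) - y (Inf w)) / measure lborel w"

definition dEa :: "nat \<Rightarrow> (real \<Rightarrow> real) \<Rightarrow> (real \<Rightarrow> real) \<Rightarrow> (real \<Rightarrow> real) \<Rightarrow> real" where
  "dEa N \<phi> y v =
     (1 / real N) * (\<Sum>i\<in>{0..<N}. \<Sum>r\<in>{1,2}.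
        deriv \<phi> (real r * diffq (bond N i r) y) * (real r * diffq (bond N i r) v))"

definition dEqc :: "nat \<Rightarrow> real set \<Rightarrow> real set \<Rightarrow> (real \<Rightarrow> real) \<Rightarrow> (real \<Rightarrow> real) \<Rightarrow> (real \<Rightarrow> real) \<Rightarrow> real" where
  "dEqc N Oa Oc \<phi> y w =
     (\<Sum>i\<in>{0..<N}. \<Sum>r\<in>{1,2}.
        measure lborel (bond N i r \<inter> Oa) * deriv \<phi> (real r * diffq (bond N i r \<inter> Oa) y)
          * diffq (bond N i r \<inter> Oa) w)
   + (\<Sum>i\<in>{0..<N}. \<Sum>r\<in>{1,2}.
        1 / real r * integral (bond N i r \<inter> Oc)
          (\<lambda>t. deriv \<phi> (real r * deriv y t) * (real r * deriv w t)))"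


section \<open>The error estimator\<close>

definition ell :: "nat \<Rightarrow> (int \<Rightarrow> real) \<Rightarrow> int \<Rightarrow> int" where
  "ell N x k = (GREATEST l. lattice N l \<le> x k)"

definition theta :: "nat \<Rightarrow> (int \<Rightarrow> real) \<Rightarrow> int \<Rightarrow> real" where
  "theta N x k = (x k - lattice N (ell N x k)) * real N"

text \<open>The constant value of \<open>y'\<close> on an element, taken at the midpoint.\<close>

definition slope :: "(int \<Rightarrow> real) \<Rightarrow> (real \<Rightarrow> real) \<Rightarrow> int \<Rightarrow> real" where
  "slope x y k = deriv y ((x (k - 1) + x k) / 2)"

text \<open>In the three definitions below, \<open>f\<close> stands for \<open>deriv \<phi>\<close>, the number \<open>g\<close> is the slope on the
  element to the left of the node, \<open>g1\<close> and \<open>g2\<close> are the slopes on the next two elements to the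
  right, and \<open>gm\<close> is the slope to the left of \<open>g\<close>.  Within each value the brackets have the same
  orientation: quasicontinuum minus atomistic stress, or the reverse throughout.\<close>

definition jump_left :: "(real \<Rightarrow> real) \<Rightarrow> real \<Rightarrow> real \<Rightarrow> real \<Rightarrow> real \<Rightarrow> nat \<Rightarrow> real" where
  "jump_left f \<theta> g g1 g2 j =
    (if j = 0 then
       f ((1 - \<theta>) * g1 + (1 + \<theta>) * g) - f (2 * g)
     else if j = 1 then
       ((1 - \<theta>) * f g1 + \<theta> * f g - f ((1 - \<theta>) * g1 + \<theta> * g))
       + ((1 - \<theta>) * f (2 / (2 - \<theta>) * g2 + 2 * (1 - \<theta>) / (2 - \<theta>) * g1) + \<theta> * f (2 * g)
          - f (g2 + (1 - \<theta>) * g1 + \<theta> * g))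
       + ((1 - \<theta>) * f (2 * g1) + \<theta> * f (2 * g) - f ((1 - \<theta>) * g1 + (1 + \<theta>) * g))
     else
       f (2 * (1 - \<theta>) / (2 - \<theta>) * g1 + 2 / (2 - \<theta>) * g2) - f (g2 + (1 - \<theta>) * g1 + \<theta> * g))"

definition jump_right :: "(real \<Rightarrow> real) \<Rightarrow> real \<Rightarrow> real \<Rightarrow> real \<Rightarrow> real \<Rightarrow> nat \<Rightarrow> real" where
  "jump_right f \<theta> gm g g1 j =
    (if j = 0 then
       f ((1 - \<theta>) * g1 + \<theta> * g + gm) - f (2 * \<theta> / (1 + \<theta>) * g + 2 / (1 + \<theta>) * gm)
     else if j = 1 then
       (\<theta> * f g + (1 - \<theta>) * f g1 - f ((1 - \<theta>) * g1 + \<theta> * g))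
       + (\<theta> * f (2 * \<theta> / (1 + \<theta>) * g + 2 / (1 + \<theta>) * gm) + (1 - \<theta>) * f (2 * g1)
          - f ((1 - \<theta>) * g1 + \<theta> * g + gm))
       + ((1 - \<theta>) * f (2 * g1) + \<theta> * f (2 * g) - f ((2 - \<theta>) * g1 + \<theta> * g))
     else
       f (2 * g1) - f ((2 - \<theta>) * g1 + \<theta> * g))"

definition jump_inner :: "(real \<Rightarrow> real) \<Rightarrow> real \<Rightarrow> real \<Rightarrow> real \<Rightarrow> nat \<Rightarrow> real" where
  "jump_inner f \<theta> g g1 j =
    (if j = 0 then
       f (2 * g) - f ((1 - \<theta>) * g1 + (1 + \<theta>) * g)
     else if j = 1 then
       ((1 - \<theta>) * f g1 + \<theta> * f g - f ((1 - \<theta>) * g1 + \<theta> * g))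
       + (2 * (1 - \<theta>) * f (2 * g1) + 2 * \<theta> * f (2 * g)
          - f ((2 - \<theta>) * g1 + \<theta> * g) - f ((1 - \<theta>) * g1 + (1 + \<theta>) * g))
     else
       f (2 * g1) - f ((2 - \<theta>) * g1 + \<theta> * g))"

text \<open>The quantity attached to node \<open>k\<close> at the lattice index \<open>ell N x k + j\<close>, for \<open>j = 0, 1, 2\<close>.

  At a right interface, the argument \<open>gm\<close> of \<open>jump_right\<close> is the slope on the lattice cell that
  ends at \<open>lattice N (ell N x k)\<close>.  This cell is the element \<open>k - 1\<close> if the node lies strictly
  between two lattice points; if the node is itself a lattice point, it is the element \<open>k\<close>.\<close>

definition jump :: "nat \<Rightarrow> (int \<Rightarrow> real) \<Rightarrow> nat \<Rightarrow> nat \<Rightarrow> (nat \<Rightarrow> int) \<Rightarrow> (nat \<Rightarrow> int) \<Rightarrow>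
    (real \<Rightarrow> real) \<Rightarrow> (real \<Rightarrow> real) \<Rightarrow> int \<Rightarrow> nat \<Rightarrow> real" where
  "jump N x K M La Ra \<phi> y k j =
     (let G = slope x y; \<theta> = theta N x k in
      if is_interface K M La k then
        jump_left (deriv \<phi>) \<theta> (G k) (G (k + 1)) (G (k + 2)) j
      else if is_interface K M Ra k then
        jump_right (deriv \<phi>) \<theta> (if \<theta> = 0 then G k else G (k - 1)) (G k) (G (k + 1)) j
      else
        jump_inner (deriv \<phi>) \<theta> (G k) (G (k + 1)) j)"

text \<open>The first case is a continuum region consisting of a single element between two atomistic
  regions; there both end nodes are interfaces and are counted with full weight.\<close>

definition eta :: "nat \<Rightarrow> (int \<Rightarrow> real) \<Rightarrow> nat \<Rightarrow> nat \<Rightarrow> (nat \<Rightarrow> int) \<Rightarrow> (nat \<Rightarrow> int) \<Rightarrow>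
    (real \<Rightarrow> real) \<Rightarrow> (real \<Rightarrow> real) \<Rightarrow> int \<Rightarrow> real" where
  "eta N x K M La Ra \<phi> y k =
     (let \<epsilon> = 1 / real N; S = (\<lambda>k. \<Sum>j\<in>{0..2}. (jump N x K M La Ra \<phi> y k j)\<^sup>2) in
      if is_interface K M La k \<and> is_interface K M Ra (k - 1) then
        sqrt (\<epsilon> * S k + \<epsilon> * S (k - 1))
      else if is_interface K M La k then
        sqrt (\<epsilon> * S k + 1/2 * \<epsilon> * S (k - 1))
      else if is_interface K M Ra (k - 1) then
        sqrt (\<epsilon> * S (k - 1) + 1/2 * \<epsilon> * S k)
      else
        sqrt (1/2 * \<epsilon> * S (k - 1) + 1/2 * \<epsilon> * S k))"

definition estimator :: "nat \<Rightarrow> real set \<Rightarrow> (int \<Rightarrow> real) \<Rightarrow> nat \<Rightarrow> nat \<Rightarrow> (nat \<Rightarrow> int) \<Rightarrow> (nat \<Rightarrow> int) \<Rightarrow>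
    (real \<Rightarrow> real) \<Rightarrow> (real \<Rightarrow> real) \<Rightarrow> real" where
  "estimator N Oc x K M La Ra \<phi> y =
     sqrt (\<Sum>k\<in>index_c x K Oc. (eta N x K M La Ra \<phi> y k)\<^sup>2)"

end

theory Submission
  imports Defs
begin

text \<open>
  Both first variations are integrals of a stress against \<open>v'\<close>: on a bond \<open>b\<close> the atomistic stress
  is \<open>\<phi>'(r D_b y)\<close>, while the quasicontinuum stress is \<open>\<phi>'(r D_{b \<inter> Oa} y)\<close> on \<open>b \<inter> Oa\<close> and
  \<open>\<phi>'(r y')\<close> on \<open>b \<inter> Oc\<close>.  (On a continuum element the stress is constant, so that only the mean
  of \<open>v'\<close> matters and the interpolation in \<open>J_U v\<close> is harmless.)  Since \<open>v'\<close> is constant on each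
  lattice cell, the consistency error is \<open>\<epsilon> \<Sum>\<^sub>l v'\<^sub>l R\<^sub>l\<close>, where \<open>R\<^sub>l\<close> is the difference
  of the mean stresses on cell \<open>l\<close>, and Cauchy-Schwarz
  bounds its norm by the square root of \<open>\<epsilon> \<Sum>\<^sub>l R\<^sub>l\<^sup>2\<close>.
  A bond contributes to \<open>R\<^sub>l\<close> only if a continuum node \<open>x k\<close> lies strictly inside it; by the
  conditions on the mesh this happens only for \<open>l = ell k + j\<close> with \<open>j \<le> 2\<close>, and then \<open>R\<^sub>l\<close> is
  the quantity \<open>jump k j\<close> up to sign.\<close>

section \<open>Integrals over partitions of the line\<close>

text \<open>On the atomistic side the interpolation is harmless for another reason:
  \<open>b \<inter> Oa\<close> is empty or an interval between two mesh nodes, and between nodes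
  \<open>J_U v\<close> and \<open>v\<close> have the same differences. So the atomistic part passes
  from \<open>J_U v\<close> to \<open>v\<close> bond by bond, whereas the continuum part does so
  only after summation over a whole period, since elements, bonds and lattice cells do not match.
  The obstacle in the local part is the number of configurations: a node inside a continuum region
  or at either interface, on or off the lattice. Two undisturbed lattice cells on each side of a
  continuum node ensure that a bond has at most one such node in its interior. All configurations
  then share one formula, \<open>defect\<close>, in which only the slopes on the neighbouring cells
  vary. The weights in \<open>eta\<close> let every continuum node count at least once: as two
  halves if both neighbouring elements are continuum elements, with full weight if only one
  is.\<close>

lemma has_integral_shift_real:
  fixes h :: "real \<Rightarrow> real"
  assumes "(h has_integral I) {a + c..b + c}"
  shows "((\<lambda>t. h (t + c)) has_integral I) {a..b}"
  using assms has_integral_shift_Icc_real[of h c I a b] by (simp add: o_def add.commute)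

definition locally_integrable :: "(real \<Rightarrow> real) \<Rightarrow> bool" where
  "locally_integrable h \<longleftrightarrow> (\<forall>a b. h integrable_on {a..b})"

lemma integral_shift_periodic:
  fixes h :: "real \<Rightarrow> real"
  assumes "h integrable_on {a + 1..b + 1}" "\<And>t. h (t + 1) = h t"
  shows "integral {a + 1..b + 1} h = integral {a..b} h"
  using has_integral_shift_real[OF integrable_integral[OF assms(1)]] assms(2)
  by (simp add: integral_unique)

text \<open>The mesh counts its period from \<open>x 0\<close>, the lattice from 0, and the element
  with index 1 in general straddles 0. The piece over \<open>{a..0}\<close> is moved by one
  period.\<close>

lemma integral_full_period:
  fixes h :: "real \<Rightarrow> real"
  assumes h: "locally_integrable h" and per: "\<And>t. h (t + 1) = h t" and a: "a \<le> 0" "0 \<le> a + 1"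
  shows "integral {a..a + 1} h = integral {0..1} h"
proof -
  have i: "h integrable_on {p..q}" for p q
    using h by (simp add: locally_integrable_def)
  have "integral {a..0} h + integral {0..a + 1} h = integral {a..a + 1} h"
    using a by (intro Henstock_Kurzweil_Integration.integral_combine i) auto
  moreover have "integral {0..a + 1} h + integral {a + 1..0 + 1} h = integral {0..0 + 1} h"
    using a by (intro Henstock_Kurzweil_Integration.integral_combine i) auto
  moreover have "integral {a + 1..0 + 1} h = integral {a..0} h"
    by (rule integral_shift_periodic[OF i per])
  ultimately show ?thesis by simp
qed

lemma integral_sum_partition:
  fixes z :: "int \<Rightarrow> real" and h :: "real \<Rightarrow> real"
  assumes "locally_integrable h" "strict_mono z"
  shows "integral {z 0..z (int n)} h = (\<Sum>l\<in>{1..int n}. integral (elem z l) h)"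
proof (induction n)
  case 0
  then show ?case by simp
next
  case (Suc n)
  have i: "h integrable_on {p..q}" for p q
    using assms(1) by (simp add: locally_integrable_def)
  have "integral {z 0..z (int n)} h + integral {z (int n)..z (int (Suc n))} h
      = integral {z 0..z (int (Suc n))} h"
    by (intro Henstock_Kurzweil_Integration.integral_combine i)
      (auto simp: strict_mono_less_eq[OF assms(2)])
  moreover have "{1..int (Suc n)} = insert (int (Suc n)) {1..int n}" by auto
  ultimately show ?case using Suc by simp
qed

lemma locally_integrable_partition:
  fixes z :: "int \<Rightarrow> real" and h :: "real \<Rightarrow> real"
  assumes z: "strict_mono z" and unb: "\<And>b. \<exists>k. b \<le> z k" "\<And>a. \<exists>k. z k \<le> a"
    and h: "\<And>k. h integrable_on elem z k"
  shows "locally_integrable h"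
  unfolding locally_integrable_def
proof (intro allI)
  fix a b
  obtain j where j: "z j \<le> a" using unb(2) by blast
  obtain k0 where "b \<le> z k0" using unb(1) by blast
  then obtain k where k: "b \<le> z k" "j \<le> k"
    by (metis linorder_linear order_trans strict_mono_less_eq[OF z])
  have "h integrable_on {z j..z k}" using k(2)
  proof (induction k rule: int_ge_induct)
    case base
    show ?case using integrable_on_refl[of h "z j"] by simp
  next
    case (step i)
    show ?case
      by (rule Henstock_Kurzweil_Integration.integrable_combine[OF _ _ step.IH])
        (use h[of "i + 1"] step.hyps in \<open>auto simp: strict_mono_less_eq[OF z]\<close>)
  qed
  then show "h integrable_on {a..b}"
    by (rule integrable_on_subinterval) (use j k in auto)
qed

text \<open>Only the open interval is prescribed, because the derivative of a piecewise affine
  function has no controlled value at a node.\<close>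

lemma has_integral_const_interior:
  fixes h :: "real \<Rightarrow> real"
  assumes "a \<le> b" "\<And>t. t \<in> {a<..<b} \<Longrightarrow> h t = c"
  shows "(h has_integral c * (b - a)) {a..b}"
proof -
  have "((\<lambda>_. c) has_integral c * (b - a)) {a..b}"
    using has_integral_const_real[of c a b] assms(1) by (simp add: mult.commute)
  then show ?thesis
    by (rule has_integral_spike_finite[of "{a, b}", rotated 2]) (use assms in auto)
qed

lemma integral_const_interior:
  fixes h :: "real \<Rightarrow> real"
  assumes "a \<le> b" "\<And>t. t \<in> {a<..<b} \<Longrightarrow> h t = c"
  shows "integral {a..b} h = c * (b - a)"
  using has_integral_const_interior[OF assms] by (rule integral_unique)

lemma integral_mult_const_interior:
  fixes h g :: "real \<Rightarrow> real"
  assumes "\<And>t. t \<in> {a<..<b} \<Longrightarrow> h t = c"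
  shows "integral {a..b} (\<lambda>t. h t * g t) = c * integral {a..b} g"
proof -
  have "integral {a..b} (\<lambda>t. h t * g t) = integral {a..b} (\<lambda>t. c * g t)"
    by (rule integral_spike[of "{a, b}"]) (use assms in auto)
  then show ?thesis by simp
qed

lemma integrable_const_interior:
  fixes h g :: "real \<Rightarrow> real"
  assumes "\<And>t. t \<in> {a<..<b} \<Longrightarrow> h t = c" "g integrable_on {a..b}"
  shows "(\<lambda>t. h t * g t) integrable_on {a..b}"
proof -
  have "(\<lambda>t. c * g t) integrable_on {a..b}"
    using integrable_cmul[OF assms(2), of c] by simp
  then show ?thesis
    by (rule integrable_spike_finite[of "{a, b}", rotated 2]) (use assms(1) in auto)
qed

text \<open>\<open>deriv\<close> chooses among the admissible derivatives, so it suffices that both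
  points admit the same ones. Hence the identity also holds at kinks, where no derivative
  exists.\<close>

lemma deriv_shift:
  fixes h :: "real \<Rightarrow> real"
  assumes "\<And>t. h (t + s) = h t + c"
  shows "deriv h (t + s) = deriv h t"
proof -
  have "(h has_field_derivative D) (at (t + s)) \<longleftrightarrow> (h has_field_derivative D) (at t)" for D
  proof -
    have "(h has_field_derivative D) (at (t + s)) \<longleftrightarrow> ((\<lambda>t. h t + c) has_field_derivative D) (at t)"
      by (simp add: DERIV_shift assms)
    also have "\<dots> \<longleftrightarrow> (h has_field_derivative D) (at t)"
      using DERIV_add[of "\<lambda>s. h s + c" D t UNIV "\<lambda>_. - c" 0] DERIV_add[of h D t UNIV "\<lambda>_. c" 0]
      by auto
    finally show ?thesis .
  qed
  then show ?thesis by (simp add: deriv_def)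
qed

section \<open>Piecewise affine functions\<close>

lemma affine_has_derivative_interior:
  fixes u :: "real \<Rightarrow> real"
  assumes "\<forall>t\<in>{p..q}. u t = a + b * t" "p < t" "t < q"
  shows "(u has_field_derivative b) (at t)"
proof -
  have "((\<lambda>t. a + b * t) has_field_derivative b) (at t)"
    by (auto intro!: derivative_eq_intros)
  then show ?thesis
    by (rule DERIV_cong_ev[THEN iffD1, rotated 3])
      (use assms in \<open>auto intro!: eventually_nhds_in_open[of "{p<..<q}", THEN eventually_mono]\<close>)
qed

lemma P1_affine:
  assumes "u \<in> P1 z" "strict_mono z"
  obtains a where "\<And>t. t \<in> elem z k \<Longrightarrow> u t = a + slope z u k * t"
proof -
  obtain a b where ab: "\<forall>t\<in>elem z k. u t = a + b * t"
    using assms(1) unfolding P1_def by blast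
  have less: "z (k - 1) < z k" using assms(2) by (simp add: strict_mono_less)
  have "deriv u ((z (k - 1) + z k) / 2) = b"
    by (rule DERIV_imp_deriv, rule affine_has_derivative_interior[OF ab]) (use less in auto)
  then show ?thesis using that[of a] ab by (simp add: slope_def)
qed

lemma P1_has_derivative:
  assumes "u \<in> P1 z" "strict_mono z" "z (k - 1) < t" "t < z k"
  shows "(u has_field_derivative slope z u k) (at t)"
proof -
  obtain a where "\<And>t. t \<in> elem z k \<Longrightarrow> u t = a + slope z u k * t"
    using P1_affine[OF assms(1,2), of k] by blast
  then show ?thesis using affine_has_derivative_interior assms(3,4) by blast
qed

lemma P1_deriv:
  assumes "u \<in> P1 z" "strict_mono z" "z (k - 1) < t" "t < z k"
  shows "deriv u t = slope z u k"
  using P1_has_derivative[OF assms] by (rule DERIV_imp_deriv)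

lemma P1_diff:
  assumes "u \<in> P1 z" "strict_mono z" "a \<in> elem z k" "b \<in> elem z k"
  shows "u b - u a = slope z u k * (b - a)"
proof -
  obtain c where "\<And>t. t \<in> elem z k \<Longrightarrow> u t = c + slope z u k * t"
    using P1_affine[OF assms(1,2), of k] by blast
  then show ?thesis using assms(3,4) by (simp add: algebra_simps)
qed

lemma interp_elem:
  assumes "strict_mono z" "z (k - 1) \<le> t" "t < z k"
  shows "interp z v t = v (z (k - 1)) + (v (z k) - v (z (k - 1))) / (z k - z (k - 1)) * (t - z (k - 1))"
proof -
  have "(THE k. z (k - 1) \<le> t \<and> t < z k) = k"
  proof (rule the_equality)
    fix j assume j: "z (j - 1) \<le> t \<and> t < z j"
    have "z (j - 1) < z k" "z (k - 1) < z j" using j assms by auto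
    then have "j - 1 < k" "k - 1 < j" by (simp_all add: strict_mono_less[OF assms(1)])
    then show "j = k" by simp
  qed (use assms in auto)
  then show ?thesis by (simp add: interp_def)
qed

lemma interp_node:
  assumes "strict_mono z"
  shows "interp z v (z k) = v (z k)"
proof -
  have "z k < z (k + 1)" by (simp add: strict_mono_less[OF assms])
  then show ?thesis using interp_elem[OF assms, of "k + 1" "z k" v] by simp
qed

lemma interp_deriv:
  assumes "strict_mono z" "z (k - 1) < t" "t < z k"
  shows "deriv (\<lambda>s. interp z v s - c) t = (v (z k) - v (z (k - 1))) / (z k - z (k - 1))"
proof -
  let ?g = "(v (z k) - v (z (k - 1))) / (z k - z (k - 1))"
  have "((\<lambda>s. p + g * (s - q) - c) has_field_derivative g) (at t)" for p q g
    by (auto intro!: derivative_eq_intros)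
  from this[of "v (z (k - 1))" ?g "z (k - 1)"]
  have "((\<lambda>s. v (z (k - 1)) + ?g * (s - z (k - 1)) - c) has_field_derivative ?g) (at t)" .
  moreover have ev: "\<forall>\<^sub>F s in nhds t. v (z (k - 1)) + ?g * (s - z (k - 1)) - c = interp z v s - c"
    by (rule eventually_nhds_in_open[of "{z (k - 1)<..<z k}", THEN eventually_mono])
      (use assms in \<open>auto simp del: times_divide_eq_left simp: interp_elem[OF assms(1), of k]\<close>)
  ultimately have "((\<lambda>s. interp z v s - c) has_field_derivative ?g) (at t)"
    by (simp only: DERIV_cong_ev[OF refl ev refl])
  then show ?thesis by (rule DERIV_imp_deriv)
qed

section \<open>The lattice\<close>

lemma strict_mono_lattice: "N > 0 \<Longrightarrow> strict_mono (lattice N)"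
  by (auto simp: strict_mono_def lattice_def divide_strict_right_mono)

lemma lattice_add: "lattice N (l + m) = lattice N l + of_int m / real N"
  by (simp add: lattice_def add_divide_distrib)

lemma lattice_shift: "N > 0 \<Longrightarrow> lattice N (l + n * int N) = lattice N l + of_int n"
  by (simp add: lattice_def add_divide_distrib)

lemma lattice_le_iff: "N > 0 \<Longrightarrow> lattice N l \<le> t \<longleftrightarrow> of_int l \<le> t * real N"
  by (simp add: lattice_def divide_le_eq)

lemma ell_eq_floor: "N > 0 \<Longrightarrow> ell N x k = \<lfloor>x k * real N\<rfloor>"
  unfolding ell_def by (rule Greatest_equality) (auto simp: lattice_le_iff le_floor_iff)

lemma lattice_unbounded:
  assumes "N > 0"
  shows "\<exists>l. b \<le> lattice N l" "\<exists>l. lattice N l \<le> b"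
proof -
  show "\<exists>l. lattice N l \<le> b" using assms
    by (intro exI[of _ "\<lfloor>b * real N\<rfloor>"]) (auto simp: lattice_le_iff)
  show "\<exists>l. b \<le> lattice N l" using assms
    by (intro exI[of _ "\<lceil>b * real N\<rceil>"]) (auto simp: lattice_def le_divide_eq)
qed

lemma finite_lattice_Int: 
  assumes "N > 0" shows "finite (range (lattice N) \<inter> {a..b})"
proof -
  have "range (lattice N) \<inter> {a..b} \<subseteq> lattice N ` {\<lceil>a * real N\<rceil>..\<lfloor>b * real N\<rfloor>}"
    using assms by (auto simp: lattice_def le_divide_eq divide_le_eq ceiling_le_iff le_floor_iff)
  then show ?thesis using finite_subset by blast
qed

lemma lattice_cell:
  assumes "N > 0"
  obtains l where "lattice N (l - 1) \<le> t" "t < lattice N l"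
proof
  show "lattice N (\<lfloor>t * real N\<rfloor> + 1 - 1) \<le> t" "t < lattice N (\<lfloor>t * real N\<rfloor> + 1)"
    using assms by (simp_all add: lattice_le_iff) (simp add: lattice_def less_divide_eq; linarith)
qed

text \<open>It is applied between mesh nodes, which need not be lattice points. The kinks of
  \<open>v\<close> in between form a finite exceptional set.\<close>

lemma lattice_P1_integral_deriv:
  assumes N: "N > 0" and v: "v \<in> P1 (lattice N)" "continuous_on UNIV v" and ab: "a \<le> b"
  shows "(deriv v has_integral v b - v a) {a..b}"
proof (rule fundamental_theorem_of_calculus_interior_strong[OF finite_lattice_Int[OF N, of a b] ab])
  fix t assume t: "t \<in> {a<..<b} - (range (lattice N) \<inter> {a..b})"
  obtain l where l: "lattice N (l - 1) \<le> t" "t < lattice N l"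
    using lattice_cell[OF N] .
  with t have "lattice N (l - 1) < t" by (cases "lattice N (l - 1) = t") auto
  then show "(v has_vector_derivative deriv v t) (at t)"
    using P1_has_derivative[OF v(1) strict_mono_lattice[OF N] _ l(2)]
      P1_deriv[OF v(1) strict_mono_lattice[OF N] _ l(2)]
    by (simp add: has_real_derivative_iff_has_vector_derivative)
qed (use v(2) in \<open>auto intro: continuous_on_subset\<close>)

section \<open>Shifting sums over one period\<close>

lemma sum_int_shift:
  fixes T :: "int \<Rightarrow> real"
  shows "(\<Sum>i\<in>{0..<N}. T (int i + 1)) = (\<Sum>l\<in>{1..int N}. T l)"
  by (rule sum.reindex_bij_witness[of _ "\<lambda>l. nat (l - 1)" "\<lambda>i. int i + 1"]) auto

lemma sum_shift_period:
  fixes T :: "int \<Rightarrow> real"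
  assumes "T (int n) = T 0"
  shows "(\<Sum>k\<in>{1..int n}. T (k - 1)) = (\<Sum>k\<in>{1..int n}. T k)"
proof -
  have "(\<Sum>k\<in>{1..int n}. T (k - 1)) + T (int n) = (\<Sum>k\<in>{1..int n}. T k) + T 0"
  proof (induction n)
    case (Suc n)
    have "{1..int (Suc n)} = insert (int n + 1) {1..int n}" by auto
    then show ?case using Suc by (simp add: add.commute)
  qed simp
  with assms show ?thesis by simp
qed

text \<open>The bond of length 2 from \<open>i\<close> covers the cells \<open>i + 1\<close> and
  \<open>i + 2\<close>. The second cell leaves the period for the last bond, which is why the terms
  at \<open>N + 1\<close> and 1 have to agree.\<close>

lemma sum_int_shift_period:
  fixes T :: "int \<Rightarrow> real"
  assumes "T (int N + 1) = T 1"
  shows "(\<Sum>i\<in>{0..<N}. T (int i + 2)) = (\<Sum>l\<in>{1..int N}. T l)"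
  using sum_int_shift[of "\<lambda>l. T (l + 1)" N] sum_shift_period[of "\<lambda>l. T (l + 1)" N] assms
  by (simp add: add.commute[of 2])

section \<open>Geometry of the mesh\<close>

context qc_mesh
begin

definition contC :: "int \<Rightarrow> bool" where "contC k \<longleftrightarrow> elem x k \<subseteq> Oc"

text \<open>The open element is used because an interface node belongs to the closed region
  \<open>Oc\<close>.\<close>

definition contA :: "int \<Rightarrow> bool" where "contA k \<longleftrightarrow> {x (k - 1)<..<x k} \<subseteq> Oa"

lemma Oa_iff: "t \<in> Oa \<longleftrightarrow> t \<notin> Oc"
  using decomposition by auto

lemma x_less [simp]: "x i < x j \<longleftrightarrow> i < j"
  by (rule strict_mono_less[OF strict_mono_x])

lemma x_le [simp]: "x i \<le> x j \<longleftrightarrow> i \<le> j"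
  by (rule strict_mono_less_eq[OF strict_mono_x])

lemma K_pos: "K > 0"
proof (rule ccontr)
  assume "\<not> K > 0"
  then show False using periodic_x[of 0] by simp
qed

lemma x_shift: "x (k + n * int K) = x k + of_int n"
proof -
  have *: "x (k + int m * int K) = x k + real m" for k m
  proof (induction m)
    case (Suc m)
    then show ?case using periodic_x[of "k + int m * int K"] by (simp add: algebra_simps)
  qed simp
  show ?thesis
  proof (cases "n \<ge> 0")
    case True
    then show ?thesis using *[of k "nat n"] by simp
  next
    case False
    then show ?thesis using *[of "k + n * int K" "nat (- n)"] by (simp add: algebra_simps)
  qed
qed

lemma Oc_shift: "t + of_int n \<in> Oc \<longleftrightarrow> t \<in> Oc"
proof -
  have *: "t + real m \<in> Oc \<longleftrightarrow> t \<in> Oc" for t m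
  proof (induction m)
    case (Suc m)
    then show ?case using periodic_regions(2)[of "t + real m"] by (simp add: algebra_simps)
  qed simp
  show ?thesis
  proof (cases "n \<ge> 0")
    case True
    then show ?thesis using *[of t "nat n"] by simp
  next
    case False
    then show ?thesis using *[of "t + of_int n" "nat (- n)"] by simp
  qed
qed

lemma Oa_shift: "t + of_int n \<in> Oa \<longleftrightarrow> t \<in> Oa"
  by (simp add: Oa_iff Oc_shift)

lemma x_unbounded: "\<exists>k. b \<le> x k" "\<exists>k. x k \<le> b"
proof -
  show "\<exists>k. b \<le> x k"
    using x_shift[of 0 "\<lceil>b - x 0\<rceil>"]
    by (intro exI[of _ "0 + \<lceil>b - x 0\<rceil> * int K"]) linarith
  show "\<exists>k. x k \<le> b"
    using x_shift[of 0 "\<lfloor>b - x 0\<rfloor>"]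
    by (intro exI[of _ "0 + \<lfloor>b - x 0\<rfloor> * int K"]) linarith
qed

lemma x_elem:
  obtains k where "x (k - 1) \<le> t" "t < x k"
proof -
  obtain a where a: "x a \<le> t" using x_unbounded by blast
  obtain b where b: "t + 1 \<le> x b" using x_unbounded by blast
  have "\<exists>k. x (k - 1) \<le> t \<and> t < x k"
  proof (rule ccontr)
    assume n: "\<nexists>k. x (k - 1) \<le> t \<and> t < x k"
    have "x k \<le> t" if "a \<le> k" for k using that
    proof (induction k rule: int_ge_induct)
      case (step i)
      then show ?case using n by (metis add_diff_cancel_right' not_less)
    qed (rule a)
    moreover have "x a < x b" using a b by linarith
    ultimately show False using b by (metis x_less less_imp_le not_less add_increasing2 zero_le_one less_add_one order_less_le_trans)
  qed
  then show ?thesis using that by blast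
qed

lemma locally_integrable_mesh:
  "(\<And>k. h integrable_on elem x k) \<Longrightarrow> locally_integrable h"
  using locally_integrable_partition[OF strict_mono_x x_unbounded] .

lemma shift_to_period:
  obtains n where "1 \<le> k + n * int K" "k + n * int K \<le> int K"
proof -
  have "(k - 1) mod int K + 1 = k + (- ((k - 1) div int K)) * int K"
    by (simp add: minus_div_mult_eq_mod[symmetric])
  then show ?thesis using that[of "- ((k - 1) div int K)"] K_pos
    by (metis add_increasing le_add_same_cancel2 of_nat_0_less_iff pos_mod_bound pos_mod_sign zle_add1_eq_le zless_imp_add1_zle)
qed

lemma contC_shift: "contC (k + n * int K) \<longleftrightarrow> contC k"
proof -
  have "contC (k + n * int K)" if "contC k" for k n
  proof -
    have "t + of_int (- n) \<in> elem x k" if "t \<in> elem x (k + n * int K)" for t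
      using that x_shift[of k n] x_shift[of "k - 1" n] by (simp add: algebra_simps)
    then show ?thesis using \<open>contC k\<close> Oc_shift by (meson contC_def subset_iff)
  qed
  from this[of k n] this[of "k + n * int K" "- n"] show ?thesis by auto
qed

lemma contA_shift: "contA (k + n * int K) \<longleftrightarrow> contA k"
proof -
  have "contA (k + n * int K)" if "contA k" for k n
  proof -
    have "t + of_int (- n) \<in> {x (k - 1)<..<x k}"
      if "t \<in> {x (k + n * int K - 1)<..<x (k + n * int K)}" for t
      using that x_shift[of k n] x_shift[of "k - 1" n] by (simp add: algebra_simps)
    then show ?thesis using \<open>contA k\<close> Oa_shift by (meson contA_def subset_iff)
  qed
  from this[of k n] this[of "k + n * int K" "- n"] show ?thesis by auto
qed

lemma is_interface_shift: "is_interface K M I (k + n * int K) \<longleftrightarrow> is_interface K M I k"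
proof -
  have "is_interface K M I k" if "is_interface K M I (k + n * int K)" for k n
  proof -
    obtain i m where "i \<in> {1..M}" "k + n * int K = I i + m * int K"
      using \<open>is_interface K M I (k + n * int K)\<close> unfolding is_interface_def by blast
    then have "k = I i + (m - n) * int K" by (simp add: algebra_simps)
    then show ?thesis using \<open>i \<in> {1..M}\<close> by (auto simp: is_interface_def)
  qed
  from this[of k n] this[of "k + n * int K" "- n"] show ?thesis by auto
qed

text \<open>A connected set that meets both \<open>Oc\<close> and its complement meets the
  frontier.\<close>

lemma interval_in_region:
  assumes "{a<..<b} \<inter> frontier Oc = {}"
  shows "{a<..<b} \<subseteq> Oa \<or> {a<..<b} \<subseteq> Oc"
proof (rule ccontr)
  assume "\<not> ({a<..<b} \<subseteq> Oa \<or> {a<..<b} \<subseteq> Oc)"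
  then have "{a<..<b} \<inter> Oc \<noteq> {}" "{a<..<b} - Oc \<noteq> {}" by (auto simp: Oa_iff)
  then have "{a<..<b} \<inter> frontier Oc \<noteq> {}"
    by (intro connected_Int_frontier) auto
  with assms show False by simp
qed

lemma contA_or_contC: "contA k \<or> contC k"
proof -
  have "{x (k - 1)<..<x k} \<inter> frontier Oc = {}"
  proof -
    have "x j \<notin> {x (k - 1)<..<x k}" for j by simp
    then show ?thesis using frontier_node by blast
  qed
  then consider "{x (k - 1)<..<x k} \<subseteq> Oa" | "{x (k - 1)<..<x k} \<subseteq> Oc"
    using interval_in_region by blast
  then show ?thesis
  proof cases
    case 2
    then have "closure {x (k - 1)<..<x k} \<subseteq> Oc"
      using closed_c by (rule closure_minimal)
    then show ?thesis by (simp add: contC_def)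
  qed (simp add: contA_def)
qed

lemma contC_nodes: "contC k \<Longrightarrow> x k \<in> Oc" "contC k \<Longrightarrow> x (k - 1) \<in> Oc"
  by (auto simp: contC_def subset_iff)

lemma not_contA_contC: "contA k \<Longrightarrow> \<not> contC k"
proof
  assume "contA k" "contC k"
  moreover obtain t where "x (k - 1) < t" "t < x k" using dense[of "x (k - 1)" "x k"] by auto
  ultimately show False by (auto simp: contA_def contC_def subset_iff Oa_iff)
qed

text \<open>Closedness of \<open>Oc\<close> adds the point 0 to the layer, and 1 in the mirrored
  lemma. This keeps interfaces away from the ends of the period.\<close>

lemma left_layer: obtains \<delta> where "\<delta> > 0" "{0..<\<delta>} \<subseteq> Oc"
proof -
  obtain \<delta> where d: "\<delta> > 2 / real N" "{0<..<\<delta>} \<union> {1 - \<delta><..<1} \<subseteq> Oc"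
    using boundary_layer by blast
  have "\<delta> > 0" using d(1) by (meson divide_nonneg_nonneg le_less_trans of_nat_0_le_iff zero_le_numeral)
  moreover have "closure {0<..<\<delta>} \<subseteq> Oc" using d closed_c by (intro closure_minimal) auto
  ultimately show ?thesis using that[of \<delta>] by (auto simp: subset_iff)
qed

lemma right_layer: obtains \<delta> where "\<delta> > 0" "{1 - \<delta><..1} \<subseteq> Oc"
proof -
  obtain \<delta> where d: "\<delta> > 2 / real N" "{0<..<\<delta>} \<union> {1 - \<delta><..<1} \<subseteq> Oc"
    using boundary_layer by blast
  have "\<delta> > 0" using d(1) by (meson divide_nonneg_nonneg le_less_trans of_nat_0_le_iff zero_le_numeral)
  moreover have "closure {1 - \<delta><..<1} \<subseteq> Oc" using d closed_c by (intro closure_minimal) auto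
  ultimately show ?thesis using that[of \<delta>] by (auto simp: subset_iff)
qed

lemma subregion_subset:
  assumes "i \<in> {1..M}" "x (La i) < t" "t < x (Ra i)"
  shows "t \<in> Oa" "0 \<le> t" "t \<le> 1"
proof -
  have "t \<in> Oa \<inter> {0..1}" unfolding subregions using assms by auto
  then show "t \<in> Oa" "0 \<le> t" "t \<le> 1" by auto
qed

lemma subregion_nodes:
  assumes i: "i \<in> {1..M}"
  shows "0 < x (La i)" "x (Ra i) < 1"
proof -
  have lt: "x (La i) < x (Ra i)" using La_less_Ra[OF i] by simp
  obtain \<delta> where d: "\<delta> > 0" "{0..<\<delta>} \<subseteq> Oc" using left_layer .
  obtain \<delta>' where d': "\<delta>' > 0" "{1 - \<delta>'<..1} \<subseteq> Oc" using right_layer .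
  show "0 < x (La i)"
  proof (rule ccontr)
    assume "\<not> 0 < x (La i)"
    then have "x (La i) < min (x (Ra i)) \<delta>" using lt d by auto
    then obtain t where "x (La i) < t" "t < min (x (Ra i)) \<delta>" using dense by blast
    then show False using subregion_subset[OF i, of t] d by (auto simp: Oa_iff)
  qed
  show "x (Ra i) < 1"
  proof (rule ccontr)
    assume "\<not> x (Ra i) < 1"
    then have "max (x (La i)) (1 - \<delta>') < x (Ra i)" using lt d' by auto
    then obtain t where "max (x (La i)) (1 - \<delta>') < t" "t < x (Ra i)" using dense by blast
    then show False using subregion_subset[OF i, of t] d' by (auto simp: Oa_iff)
  qed
qed

lemma subregion_exists:
  assumes "t \<in> Oa" "0 \<le> t" "t \<le> 1"
  obtains i where "i \<in> {1..M}" "x (La i) < t" "t < x (Ra i)"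
proof -
  have "t \<in> Oa \<inter> {0..1}" using assms by simp
  then have "t \<in> (\<Union>i\<in>{1..M}. {x (La i)<..<x (Ra i)})" by (simp only: subregions)
  then show ?thesis using that by auto
qed

text \<open>If the element to the left were atomistic, points just left of \<open>x (La i)\<close>
  would lie in another subregion. The closure of that subregion would contain
  \<open>x (La i)\<close>, against \<open>separated\<close>.\<close>

lemma La_regions:
  assumes i: "i \<in> {1..M}"
  shows "contC (La i)" "contA (La i + 1)"
proof -
  have lt: "La i < Ra i" using La_less_Ra[OF i] .
  show "contA (La i + 1)"
    using subregion_subset(1)[OF i] lt order_less_le_trans[of _ "x (La i + 1)" "x (Ra i)"]
    by (auto simp: contA_def)
  show "contC (La i)"
  proof (rule ccontr)
    assume "\<not> contC (La i)"
    then have A: "contA (La i)" using contA_or_contC by blast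
    have "max 0 (x (La i - 1)) < x (La i)" using subregion_nodes(1)[OF i] by simp
    then obtain t where t: "max 0 (x (La i - 1)) < t" "t < x (La i)" using dense by blast
    then have "t \<in> Oa" "0 \<le> t" "t \<le> 1"
      using A subregion_nodes(2)[OF i] lt x_less[of "La i" "Ra i"] 
      by (auto simp: contA_def subset_iff simp del: x_less)
    then obtain j where j: "j \<in> {1..M}" "x (La j) < t" "t < x (Ra j)" using subregion_exists by blast
    have "i \<noteq> j" using j t by auto
    have "x (La j) < x (La i)" "x (La i - 1) < x (Ra j)" using j t by linarith+
    then have "x (La i) \<in> {x (La i)..x (Ra i)} \<inter> {x (La j)..x (Ra j)}" using lt by auto
    then show False using separated[OF i j(1) \<open>i \<noteq> j\<close>] by blast
  qed
qed

lemma Ra_regions: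
  assumes i: "i \<in> {1..M}"
  shows "contA (Ra i)" "contC (Ra i + 1)"
proof -
  have lt: "La i < Ra i" using La_less_Ra[OF i] .
  show "contA (Ra i)"
    using subregion_subset(1)[OF i] lt order_le_less_trans[of "x (La i)" "x (Ra i - 1)"]
    by (auto simp: contA_def)
  show "contC (Ra i + 1)"
  proof (rule ccontr)
    assume "\<not> contC (Ra i + 1)"
    then have A: "contA (Ra i + 1)" using contA_or_contC by blast
    have "x (Ra i) < min 1 (x (Ra i + 1))" using subregion_nodes(2)[OF i] by simp
    then obtain t where t: "x (Ra i) < t" "t < min 1 (x (Ra i + 1))" using dense by blast
    then have "t \<in> Oa" "0 \<le> t" "t \<le> 1"
      using A subregion_nodes(1)[OF i] lt x_less[of "La i" "Ra i"]
      by (auto simp: contA_def subset_iff simp del: x_less)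
    then obtain j where j: "j \<in> {1..M}" "x (La j) < t" "t < x (Ra j)" using subregion_exists by blast
    have "i \<noteq> j" using j t by auto
    have "x (La j) < x (Ra i + 1)" "x (Ra i) < x (Ra j)" using j t by linarith+
    then have "x (Ra i) \<in> {x (La i)..x (Ra i)} \<inter> {x (La j)..x (Ra j)}" using lt by auto
    then show False using separated[OF i j(1) \<open>i \<noteq> j\<close>] by blast
  qed
qed

lemma period_nodes: "1 \<le> k \<Longrightarrow> k \<le> int K \<Longrightarrow> 0 \<le> x k \<and> x k \<le> 1"
  using leftmost(1) rightmost(1) x_le[of 1 k] x_le[of k "int K"] by linarith

text \<open>This replaces the enumeration of subregions by a condition on the neighbourhood of the
  node, which is what the local analysis can use. The condition \<open>x k \<in> Oc\<close>
  separates interfaces from nodes inside an atomistic region.\<close>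

lemma is_interface_La: "is_interface K M La k \<longleftrightarrow> x k \<in> Oc \<and> contA (k + 1)"
proof
  assume "is_interface K M La k"
  then obtain i n where "i \<in> {1..M}" "k = La i + n * int K" unfolding is_interface_def by blast
  then show "x k \<in> Oc \<and> contA (k + 1)"
    using La_regions[of i] contC_nodes(1)[of k] contC_shift[of "La i" n] contA_shift[of "La i + 1" n]
    by (simp add: algebra_simps)
next
  assume "x k \<in> Oc \<and> contA (k + 1)"
  obtain n where n: "1 \<le> k + n * int K" "k + n * int K \<le> int K" using shift_to_period[of k] .
  define m where "m = k + n * int K"
  have m: "x m \<in> Oc" "contA (m + 1)" "0 \<le> x m" "x m \<le> 1"
  proof -
    have "m + 1 = k + 1 + n * int K" by (simp add: m_def)
    then show "contA (m + 1)"
      using \<open>x k \<in> Oc \<and> contA (k + 1)\<close> contA_shift[of "k + 1" n] by (simp only:)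
    show "x m \<in> Oc"
      using \<open>x k \<in> Oc \<and> contA (k + 1)\<close> Oc_shift[of "x k" n] x_shift[of k n]
      unfolding m_def by simp
    show "0 \<le> x m" "x m \<le> 1" using period_nodes[of m] n unfolding m_def by simp_all
  qed
  \<comment> \<open>The layer of the next period starts at 1, so no atomistic element does. This
    leaves room for a test point to the right of \<open>x m\<close> within the period.\<close>
  have "x m \<noteq> 1"
  proof
    assume "x m = 1"
    obtain \<delta> where d: "\<delta> > 0" "{0..<\<delta>} \<subseteq> Oc" using left_layer .
    have "x m < min (x (m + 1)) (1 + \<delta>)" using d \<open>x m = 1\<close> x_less[of m "m + 1"] by (simp del: x_less)
    then obtain t where t: "x m < t" "t < min (x (m + 1)) (1 + \<delta>)" using dense by blast
    then have "t \<in> Oa" using m(2) by (auto simp: contA_def)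
    moreover have "t - 1 \<in> Oc" using t d \<open>x m = 1\<close> by (auto simp: subset_iff)
    ultimately show False using periodic_regions(2)[of "t - 1"] by (simp add: Oa_iff)
  qed
  then have "x m < min 1 (x (m + 1))" using m by simp
  then obtain t where t: "x m < t" "t < min 1 (x (m + 1))" using dense by blast
  then have "t \<in> Oa" "0 \<le> t" "t \<le> 1" using m by (auto simp: contA_def subset_iff)
  then obtain i where i: "i \<in> {1..M}" "x (La i) < t" "t < x (Ra i)" using subregion_exists by blast
  have "x (La i) < x (m + 1)" "x m < x (Ra i)" using i t by linarith+
  then have "La i \<le> m" "m < Ra i" by auto
  moreover have "\<not> La i < m"
    using subregion_subset(1)[OF i(1), of "x m"] m(1) \<open>m < Ra i\<close> by (auto simp: Oa_iff)
  ultimately have "m = La i" by simp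
  then have "is_interface K M La m"
    unfolding is_interface_def using i(1) by (intro bexI[of _ i] exI[of _ 0]) auto
  then show "is_interface K M La k" by (simp add: m_def is_interface_shift)
qed

lemma is_interface_Ra: "is_interface K M Ra k \<longleftrightarrow> x k \<in> Oc \<and> contA k"
proof
  assume "is_interface K M Ra k"
  then obtain i n where "i \<in> {1..M}" "k = Ra i + n * int K" unfolding is_interface_def by blast
  then show "x k \<in> Oc \<and> contA k"
    using Ra_regions[of i] contC_nodes(2)[of "k + 1"] contC_shift[of "Ra i + 1" n] contA_shift[of "Ra i" n]
    by (simp add: algebra_simps)
next
  assume "x k \<in> Oc \<and> contA k"
  obtain n where n: "1 \<le> k + n * int K" "k + n * int K \<le> int K" using shift_to_period[of k] .
  define m where "m = k + n * int K"
  have m: "x m \<in> Oc" "contA m" "0 \<le> x m" "x m \<le> 1"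
  proof -
    show "x m \<in> Oc" "contA m"
      using \<open>x k \<in> Oc \<and> contA k\<close> contA_shift[of k n] Oc_shift[of "x k" n] x_shift[of k n]
      unfolding m_def by simp_all
    show "0 \<le> x m" "x m \<le> 1" using period_nodes[of m] n unfolding m_def by simp_all
  qed
  \<comment> \<open>Otherwise the atomistic element \<open>m\<close> would reach into the layer at
    the end of the previous period.\<close>
  have "x m \<noteq> 0"
  proof
    assume "x m = 0"
    obtain \<delta> where d: "\<delta> > 0" "{1 - \<delta><..1} \<subseteq> Oc" using right_layer .
    have "max (x (m - 1)) (- \<delta>) < x m" using d \<open>x m = 0\<close> x_less[of "m - 1" m] by (simp del: x_less)
    then obtain t where t: "max (x (m - 1)) (- \<delta>) < t" "t < x m" using dense by blast
    then have "t \<in> Oa" using m(2) by (auto simp: contA_def)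
    moreover have "t + 1 \<in> Oc" using t d \<open>x m = 0\<close> by (auto simp: subset_iff)
    ultimately show False using periodic_regions(2)[of t] by (simp add: Oa_iff)
  qed
  then have "max 0 (x (m - 1)) < x m" using m by simp
  then obtain t where t: "max 0 (x (m - 1)) < t" "t < x m" using dense by blast
  then have "t \<in> Oa" "0 \<le> t" "t \<le> 1" using m by (auto simp: contA_def subset_iff)
  then obtain i where i: "i \<in> {1..M}" "x (La i) < t" "t < x (Ra i)" using subregion_exists by blast
  have "x (La i) < x m" "x (m - 1) < x (Ra i)" using i t by linarith+
  then have "La i < m" "m \<le> Ra i" by auto
  moreover have "\<not> m < Ra i"
    using subregion_subset(1)[OF i(1), of "x m"] m(1) \<open>La i < m\<close> by (auto simp: Oa_iff)
  ultimately have "m = Ra i" by simp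
  then have "is_interface K M Ra m"
    unfolding is_interface_def using i(1) by (intro bexI[of _ i] exI[of _ 0]) auto
  then show "is_interface K M Ra k" by (simp add: m_def is_interface_shift)
qed

text \<open>Excludes a continuum region that consists of a single point between two atomistic
  elements.\<close>

lemma contA_left_neighbour: "contA (k + 1) \<Longrightarrow> x k \<in> Oc \<Longrightarrow> contC k"
proof -
  assume "contA (k + 1)" "x k \<in> Oc"
  then obtain i n where "i \<in> {1..M}" "k = La i + n * int K"
    using is_interface_La unfolding is_interface_def by blast
  then show ?thesis using La_regions(1) contC_shift by simp
qed

lemma contA_right_neighbour: "contA k \<Longrightarrow> x k \<in> Oc \<Longrightarrow> contC (k + 1)"
proof -
  assume "contA k" "x k \<in> Oc"
  then obtain i n where "i \<in> {1..M}" "k = Ra i + n * int K"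
    using is_interface_Ra unfolding is_interface_def by blast
  then show ?thesis using Ra_regions(2) contC_shift[of "Ra i + 1" n] by (simp add: algebra_simps)
qed

end

text \<open>Up to sign, the common form of the three kinds of jumps: \<open>gm\<close>, \<open>g2\<close> are the slopes on the lattice cells
  next to the cell which contains the node, \<open>g\<close>, \<open>g1\<close> those on the two parts of that cell.\<close>

definition defect :: "(real \<Rightarrow> real) \<Rightarrow> real \<Rightarrow> real \<Rightarrow> real \<Rightarrow> real \<Rightarrow> real \<Rightarrow> nat \<Rightarrow> real" where
  "defect f \<theta> gm g g1 g2 j =
    (if j = 0 then
       f (gm + \<theta> * g + (1 - \<theta>) * g1) - f (2 * ((gm + \<theta> * g) / (1 + \<theta>)))
     else if j = 1 then
       (f (\<theta> * g + (1 - \<theta>) * g1) - \<theta> * f g - (1 - \<theta>) * f g1)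
       + (f (gm + \<theta> * g + (1 - \<theta>) * g1) - \<theta> * f (2 * ((gm + \<theta> * g) / (1 + \<theta>)))
          - (1 - \<theta>) * f (2 * g1))
       + (f (\<theta> * g + (1 - \<theta>) * g1 + g2) - \<theta> * f (2 * g)
          - (1 - \<theta>) * f (2 * (((1 - \<theta>) * g1 + g2) / (2 - \<theta>))))
     else
       f (\<theta> * g + (1 - \<theta>) * g1 + g2) - f (2 * (((1 - \<theta>) * g1 + g2) / (2 - \<theta>))))"

text \<open>Squares are compared because the sign depends on the kind of node: here it is -1
  throughout, while at an interface the term with \<open>j = 0\<close> keeps the sign +1.\<close>

lemma defect_inner:
  assumes "0 \<le> \<theta>" "\<theta> < 1"
  shows "(defect f \<theta> g g g1 g1 j)\<^sup>2 = (jump_inner f \<theta> g g1 j)\<^sup>2"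
proof -
  have 1: "(g + \<theta> * g) / (1 + \<theta>) = g" "((1 - \<theta>) * g1 + g1) / (2 - \<theta>) = g1"
    using assms by (simp_all add: field_simps)
  have 2: "g + \<theta> * g + (1 - \<theta>) * g1 = (1 - \<theta>) * g1 + (1 + \<theta>) * g"
    "\<theta> * g + (1 - \<theta>) * g1 + g1 = (2 - \<theta>) * g1 + \<theta> * g"
    "\<theta> * g + (1 - \<theta>) * g1 = (1 - \<theta>) * g1 + \<theta> * g"
    by (simp_all add: algebra_simps)
  have "defect f \<theta> g g g1 g1 j = - jump_inner f \<theta> g g1 j"
    unfolding defect_def 1 2 jump_inner_def by (simp add: algebra_simps)
  then show ?thesis by simp
qed

lemma defect_left:
  assumes "0 \<le> \<theta>" "\<theta> < 1"
  shows "(defect f \<theta> g g g1 g2 j)\<^sup>2 = (jump_left f \<theta> g g1 g2 j)\<^sup>2"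
proof -
  have 1: "(g + \<theta> * g) / (1 + \<theta>) = g"
    using assms by (simp_all add: field_simps)
  have 2: "g + \<theta> * g + (1 - \<theta>) * g1 = (1 - \<theta>) * g1 + (1 + \<theta>) * g"
    "\<theta> * g + (1 - \<theta>) * g1 + g2 = g2 + (1 - \<theta>) * g1 + \<theta> * g"
    "\<theta> * g + (1 - \<theta>) * g1 = (1 - \<theta>) * g1 + \<theta> * g"
    "2 * (((1 - \<theta>) * g1 + g2) / (2 - \<theta>)) = 2 / (2 - \<theta>) * g2 + 2 * (1 - \<theta>) / (2 - \<theta>) * g1"
    "2 * (1 - \<theta>) / (2 - \<theta>) * g1 + 2 / (2 - \<theta>) * g2 = 2 / (2 - \<theta>) * g2 + 2 * (1 - \<theta>) / (2 - \<theta>) * g1"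
    by (simp_all add: add_divide_distrib diff_divide_distrib algebra_simps)
  have "defect f \<theta> g g g1 g2 j = (if j = 0 then 1 else - 1) * jump_left f \<theta> g g1 g2 j"
    unfolding defect_def jump_left_def 1 2 by (simp add: algebra_simps)
  then show ?thesis by simp
qed

lemma defect_right:
  assumes "0 \<le> \<theta>" "\<theta> < 1"
  shows "(defect f \<theta> gm g g1 g1 j)\<^sup>2 = (jump_right f \<theta> gm g g1 j)\<^sup>2"
proof -
  have 1: "((1 - \<theta>) * g1 + g1) / (2 - \<theta>) = g1"
    using assms by (simp_all add: field_simps)
  have 2: "gm + \<theta> * g + (1 - \<theta>) * g1 = (1 - \<theta>) * g1 + \<theta> * g + gm"
    "\<theta> * g + (1 - \<theta>) * g1 + g1 = (2 - \<theta>) * g1 + \<theta> * g"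
    "\<theta> * g + (1 - \<theta>) * g1 = (1 - \<theta>) * g1 + \<theta> * g"
    "2 * ((gm + \<theta> * g) / (1 + \<theta>)) = 2 * \<theta> / (1 + \<theta>) * g + 2 / (1 + \<theta>) * gm"
    by (simp_all add: add_divide_distrib diff_divide_distrib algebra_simps)
  have "defect f \<theta> gm g g1 g1 j = (if j = 0 then 1 else - 1) * jump_right f \<theta> gm g g1 j"
    unfolding defect_def jump_right_def 1 2 by (simp add: algebra_simps)
  then show ?thesis by simp
qed

section \<open>Local residuals\<close>

lemma diffq_interval:
  assumes "a < b"
  shows "diffq {a<..<b} h = (h b - h a) / (b - a)"
  using assms by (simp add: diffq_def)

locale qc_deformation = qc_mesh +
  fixes \<phi> y :: "real \<Rightarrow> real" and F :: real
  assumes y_space: "y \<in> space_Yqc F x"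
begin

abbreviation "f \<equiv> deriv \<phi>"
abbreviation "L \<equiv> lattice N"
abbreviation "G \<equiv> slope x y"
abbreviation "\<theta> \<equiv> theta N x"
abbreviation "e \<equiv> ell N x"

definition secant :: "real \<Rightarrow> real \<Rightarrow> real" where
  "secant a b = (y b - y a) / (b - a)"

text \<open>The start index is an integer because cell 1 is also covered by the bond that starts at
  -1.\<close>

definition bnd :: "int \<Rightarrow> nat \<Rightarrow> real set" where
  "bnd i r = {L i<..<L (i + int r)}"

text \<open>The quasicontinuum stress of the bond \<open>bnd i r\<close>; only its values on that bond matter.\<close>

definition stress :: "int \<Rightarrow> nat \<Rightarrow> real \<Rightarrow> real" where
  "stress i r t =
     (if t \<in> Oa then f (real r * diffq (bnd i r \<inter> Oa) y) else f (real r * deriv y t))"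

text \<open>Atomistic stress minus the mean quasicontinuum stress on cell \<open>l\<close>; the
  factor \<open>real N\<close> is the reciprocal of the cell length.\<close>

definition bond_error :: "int \<Rightarrow> nat \<Rightarrow> int \<Rightarrow> real" where
  "bond_error i r l = f (real r * secant (L i) (L (i + int r)))
     - real N * integral (elem L l) (stress i r)"

text \<open>The three terms belong to the three bonds of length at most 2 that cover cell
  \<open>l\<close>.\<close>

definition residual :: "int \<Rightarrow> real" where
  "residual l = bond_error (l - 1) 1 l + bond_error (l - 1) 2 l + bond_error (l - 2) 2 l"

text \<open>The two cases differ because the atomistic stress is one difference quotient,
  indifferent to nodes inside the interval, whereas the continuum stress follows the slope and may
  jump at every node.\<close>

definition homogeneous :: "real \<Rightarrow> real \<Rightarrow> bool" where
  "homogeneous a b \<longleftrightarrow> {a<..<b} \<subseteq> Oa \<or> (\<exists>k. contC k \<and> {a..b} \<subseteq> elem x k)"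

lemma y_P1: "y \<in> P1 x"
proof -
  obtain u where u: "u \<in> P1 x" "y = (\<lambda>t. F * t + u t)"
    using y_space by (auto simp: space_Yqc_def space_Uqc_def periodic_P1_def)
  have "\<exists>a b. \<forall>t\<in>elem x k. y t = a + b * t" for k
  proof -
    obtain a b where "\<forall>t\<in>elem x k. u t = a + b * t"
      using u(1) unfolding P1_def by blast
    then have "\<forall>t\<in>elem x k. y t = a + (F + b) * t" by (simp add: u(2) algebra_simps)
    then show ?thesis by blast
  qed
  then show ?thesis by (simp add: P1_def)
qed

lemma y_shift: "y (t + 1) = y t + F"
  using y_space by (auto simp: space_Yqc_def space_Uqc_def periodic_P1_def algebra_simps)

lemmas y_diff = P1_diff[OF y_P1 strict_mono_x]
lemmas y_deriv = P1_deriv[OF y_P1 strict_mono_x]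

lemma N_real: "real N > 0"
  using N_pos by simp

lemma L_less [simp]: "L i < L j \<longleftrightarrow> i < j"
  by (rule strict_mono_less[OF strict_mono_lattice[OF N_pos]])

lemma L_le [simp]: "L i \<le> L j \<longleftrightarrow> i \<le> j"
  by (rule strict_mono_less_eq[OF strict_mono_lattice[OF N_pos]])

lemma L_diff: "L j - L i = of_int (j - i) / real N"
  by (simp add: lattice_def diff_divide_distrib)

lemma secant_slope:
  assumes "a < b" "x (k - 1) \<le> a" "b \<le> x k"
  shows "secant a b = G k"
  using y_diff[of a k b] assms by (simp add: secant_def)

lemma stress_contC:
  assumes "contC k" "x (k - 1) \<le> a" "b \<le> x k" "a < t" "t < b"
  shows "stress i r t = f (real r * secant a b)"
proof -
  have "t \<in> elem x k" using assms by simp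
  then have "t \<in> Oc" using \<open>contC k\<close> unfolding contC_def by blast
  moreover have "deriv y t = G k" using assms by (intro y_deriv) linarith+
  moreover have "secant a b = G k" using assms by (intro secant_slope) linarith+
  ultimately show ?thesis by (simp add: stress_def Oa_iff)
qed

lemma stress_contA:
  assumes "bnd i r \<inter> Oa = {a<..<b}" "a < t" "t < b"
  shows "stress i r t = f (real r * secant a b)"
proof -
  have "t \<in> bnd i r \<inter> Oa" unfolding assms(1) using assms(2,3) by simp
  then have "t \<in> Oa" by blast
  moreover have "a < b" using assms by simp
  ultimately show ?thesis using assms(1) by (simp add: stress_def diffq_interval secant_def)
qed

lemma homogeneous_subset:
  assumes "homogeneous a b" "a \<le> a'" "b' \<le> b"
  shows "homogeneous a' b'"
proof -
  have "{a'<..<b'} \<subseteq> {a<..<b}" "{a'..b'} \<subseteq> {a..b}" using assms by auto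
  with assms(1) show ?thesis unfolding homogeneous_def by blast
qed

lemma homogeneous_stress:
  assumes "homogeneous (L i) (L (i + int r))" "L i < t" "t < L (i + int r)"
  shows "stress i r t = f (real r * secant (L i) (L (i + int r)))"
  using assms(1) unfolding homogeneous_def
proof (elim disjE exE conjE)
  assume "{L i<..<L (i + int r)} \<subseteq> Oa"
  then show ?thesis using assms by (intro stress_contA) (auto simp: bnd_def)
next
  fix k assume "contC k" "{L i..L (i + int r)} \<subseteq> elem x k"
  then show ?thesis using assms by (intro stress_contC) auto
qed

text \<open>On such a bond both models have the same constant stress.\<close>

lemma bond_error_homogeneous:
  assumes "homogeneous (L i) (L (i + int r))" "i < l" "l \<le> i + int r"
  shows "bond_error i r l = 0"
proof -
  have "integral (elem L l) (stress i r) = f (real r * secant (L i) (L (i + int r))) * (L l - L (l - 1))"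
  proof (rule integral_const_interior)
    fix t assume "t \<in> {L (l - 1)<..<L l}"
    then have "L (l - 1) < t" "t < L l" by simp_all
    moreover have "L i \<le> L (l - 1)" "L l \<le> L (i + int r)" using assms by simp_all
    ultimately show "stress i r t = f (real r * secant (L i) (L (i + int r)))"
      by (intro homogeneous_stress[OF assms(1)]) linarith+
  qed simp
  then show ?thesis using N_real by (simp add: bond_error_def L_diff)
qed

text \<open>If one half is atomistic, the other lies in \<open>Oc\<close>, so the atomistic part of
  the bond is exactly that half and its difference quotient is the secant of the half. Were both
  halves atomistic, \<open>diffq\<close> would ignore the gap at \<open>z\<close> and give the
  secant of the whole bond; the last assumption rules this out.\<close>

lemma stress_split:
  assumes p: "L i < z" "z < L (i + int r)" and z: "z \<notin> Oa"
    and h: "homogeneous (L i) z" "homogeneous z (L (i + int r))"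
    and n: "\<not> ({L i<..<z} \<subseteq> Oa \<and> {z<..<L (i + int r)} \<subseteq> Oa)"
  shows "L i < t \<Longrightarrow> t < z \<Longrightarrow> stress i r t = f (real r * secant (L i) z)"
    and "z < t \<Longrightarrow> t < L (i + int r) \<Longrightarrow> stress i r t = f (real r * secant z (L (i + int r)))"
proof -
  let ?q = "L (i + int r)"
  have C: "stress i r t = f (real r * secant a b)"
    if "contC k" "{a..b} \<subseteq> elem x k" "a < t" "t < b" for k a b t
    using that by (intro stress_contC[of k]) auto
  have CO: "{a<..<b} \<inter> Oa = {}" if "contC k" "{a..b} \<subseteq> elem x k" for k a b
  proof -
    have "{a<..<b} \<subseteq> {a..b}" by auto
    then show ?thesis using that decomposition(2) unfolding contC_def by blast
  qed
  have un: "bnd i r = {L i<..<z} \<union> {z} \<union> {z<..<?q}" using p by (auto simp: bnd_def)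
  show "stress i r t = f (real r * secant (L i) z)" if t: "L i < t" "t < z" for t
  proof (cases "{L i<..<z} \<subseteq> Oa")
    case True
    then obtain k where "contC k" "{z..?q} \<subseteq> elem x k"
      using h n unfolding homogeneous_def by blast
    from CO[OF this] have "bnd i r \<inter> Oa = {L i<..<z}" using True z unfolding un by blast
    then show ?thesis using t by (rule stress_contA)
  next
    case False
    then show ?thesis using h(1) C t unfolding homogeneous_def by blast
  qed
  show "stress i r t = f (real r * secant z ?q)" if t: "z < t" "t < ?q" for t
  proof (cases "{z<..<?q} \<subseteq> Oa")
    case True
    then obtain k where "contC k" "{L i..z} \<subseteq> elem x k"
      using h n unfolding homogeneous_def by blast
    from CO[OF this] have "bnd i r \<inter> Oa = {z<..<?q}" using True z unfolding un by blast
    then show ?thesis using t by (rule stress_contA)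
  next
    case False
    then show ?thesis using h(2) C t unfolding homogeneous_def by blast
  qed
qed

section \<open>Lattice windows on both sides of a continuum node\<close>

lemma e_floor: "e k = \<lfloor>x k * real N\<rfloor>"
  by (rule ell_eq_floor[OF N_pos])

lemma L_le_x: "L l \<le> x k \<longleftrightarrow> l \<le> e k"
  by (simp add: lattice_le_iff[OF N_pos] e_floor le_floor_iff)

lemma x_eq: "x k = L (e k) + \<theta> k / real N"
  using N_real by (simp add: theta_def)

lemma theta_bounds: "0 \<le> \<theta> k" "\<theta> k < 1"
proof -
  have "\<theta> k = x k * real N - of_int (e k)" using N_real by (simp add: theta_def lattice_def field_simps)
  then show "0 \<le> \<theta> k" "\<theta> k < 1" unfolding e_floor by linarith+
qed

lemma theta_pos_iff: "0 < \<theta> k \<longleftrightarrow> L (e k) < x k"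
  using N_real by (simp add: theta_def zero_less_mult_iff)

definition ceil_ell :: "int \<Rightarrow> int" where "ceil_ell k = (if \<theta> k = 0 then e k else e k + 1)"

lemma x_le_L: "x k \<le> L l \<longleftrightarrow> ceil_ell k \<le> l"
proof (cases "\<theta> k = 0")
  case True
  then show ?thesis using x_eq[of k] by (simp add: ceil_ell_def)
next
  case False
  then have "L (e k) < x k" using theta_bounds[of k] theta_pos_iff[of k] by simp
  moreover have "x k < L (e k + 1)" using L_le_x[of "e k + 1" k] by simp
  ultimately show ?thesis using False L_le_x[of l k] L_le[of "e k + 1" l] 
    by (smt (verit) ceil_ell_def L_le)
qed

text \<open>The two full cells that the element contains somewhere can be pushed against its right
  end, since \<open>e k\<close> is the last lattice index not beyond the node.\<close>

lemma left_window_C: "contC k \<Longrightarrow> x (k - 1) \<le> L (e k - 2)"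
proof -
  assume "contC k"
  then obtain l where l: "x (k - 1) \<le> L l" "L (l + 2) \<le> x k"
    using two_cells_c by (auto simp: contC_def)
  then have "L l \<le> L (e k - 2)" by (simp add: L_le_x)
  with l show ?thesis by linarith
qed

lemma right_window_C: "contC (k + 1) \<Longrightarrow> L (ceil_ell k + 2) \<le> x (k + 1)"
proof -
  assume "contC (k + 1)"
  then obtain l where l: "x k \<le> L l" "L (l + 2) \<le> x (k + 1)"
    using two_cells_c[of "k + 1"] by (auto simp: contC_def)
  then have "L (ceil_ell k + 2) \<le> L (l + 2)" by (simp add: x_le_L)
  with l show ?thesis by linarith
qed

text \<open>Atomistic elements are at most one cell long, so the window may span several of them.
  The room for it comes from the whole subregion, through \<open>two_cells_a\<close>, after a shift
  into the period.\<close>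

lemma left_window_A:
  assumes "contA k" "x k \<in> Oc"
  shows "{L (e k - 2)<..<x k} \<subseteq> Oa"
proof -
  obtain i n where i: "i \<in> {1..M}" "k = Ra i + n * int K"
    using assms is_interface_Ra[of k] unfolding is_interface_def by blast
  obtain l where l: "x (La i) \<le> L l" "L (l + 2) \<le> x (Ra i)"
    using two_cells_a[OF i(1)] by blast
  have xk: "x k = x (Ra i) + of_int n" using x_shift i(2) by simp
  have "L (l + 2 + n * int N) \<le> x k"
    using l(2) xk lattice_shift[OF N_pos, of "l + 2" n] by simp
  then have "L (l + n * int N) \<le> L (e k - 2)" by (simp add: L_le_x)
  then have "x (La i) + of_int n \<le> L (e k - 2)"
    using l(1) lattice_shift[OF N_pos, of l n] by simp
  then have "t + of_int (- n) \<in> Oa" if "t \<in> {L (e k - 2)<..<x k}" for t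
    using that xk by (intro subregion_subset(1)[OF i(1)]) auto
  then show ?thesis using Oa_shift by blast
qed

lemma right_window_A:
  assumes "contA (k + 1)" "x k \<in> Oc"
  shows "{x k<..<L (ceil_ell k + 2)} \<subseteq> Oa"
proof -
  obtain i n where i: "i \<in> {1..M}" "k = La i + n * int K"
    using assms is_interface_La[of k] unfolding is_interface_def by blast
  obtain l where l: "x (La i) \<le> L l" "L (l + 2) \<le> x (Ra i)"
    using two_cells_a[OF i(1)] by blast
  have xk: "x k = x (La i) + of_int n" using x_shift i(2) by simp
  have "x k \<le> L (l + n * int N)"
    using l(1) xk lattice_shift[OF N_pos, of l n] by simp
  then have "L (ceil_ell k + 2) \<le> L (l + 2 + n * int N)" by (simp add: x_le_L)
  then have "L (ceil_ell k + 2) \<le> x (Ra i) + of_int n"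
    using l(2) lattice_shift[OF N_pos, of "l + 2" n] by simp
  then have "t + of_int (- n) \<in> Oa" if "t \<in> {x k<..<L (ceil_ell k + 2)}" for t
    using that xk by (intro subregion_subset(1)[OF i(1)]) auto
  then show ?thesis using Oa_shift by blast
qed

lemma left_window:
  assumes "x k \<in> Oc" "L (e k - 2) \<le> a" "b \<le> x k"
  shows "homogeneous a b"
proof -
  have "homogeneous (L (e k - 2)) (x k)"
  proof (cases "contA k")
    case True
    then show ?thesis using left_window_A assms by (simp add: homogeneous_def)
  next
    case False
    then have "contC k" using contA_or_contC by blast
    then have "{L (e k - 2)..x k} \<subseteq> elem x k" using left_window_C by auto
    then show ?thesis using \<open>contC k\<close> unfolding homogeneous_def by blast
  qed
  then show ?thesis using assms(2,3) by (rule homogeneous_subset)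
qed

text \<open>The window ends at \<open>L (e k + 3)\<close> in general, but already at
  \<open>L (e k + 2)\<close> if the node is a lattice point. This is why
  \<open>residual_node_2\<close> carries a hypothesis of its own.\<close>

lemma right_window:
  assumes "x k \<in> Oc" "x k \<le> a" "b \<le> L (ceil_ell k + 2)"
  shows "homogeneous a b"
proof -
  have "homogeneous (x k) (L (ceil_ell k + 2))"
  proof (cases "contA (k + 1)")
    case True
    then show ?thesis using right_window_A assms by (simp add: homogeneous_def)
  next
    case False
    then have "contC (k + 1)" using contA_or_contC by blast
    then have "{x k..L (ceil_ell k + 2)} \<subseteq> elem x (k + 1)" using right_window_C by auto
    then show ?thesis using \<open>contC (k + 1)\<close> unfolding homogeneous_def by blast
  qed
  then show ?thesis using assms(2,3) by (rule homogeneous_subset)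
qed

lemma not_both_A:
  assumes "x k \<in> Oc" "a < x k" "x k < b"
  shows "\<not> ({a<..<x k} \<subseteq> Oa \<and> {x k<..<b} \<subseteq> Oa)"
proof
  assume A: "{a<..<x k} \<subseteq> Oa \<and> {x k<..<b} \<subseteq> Oa"
  have "max a (x (k - 1)) < x k" using assms by simp
  then obtain s where s: "max a (x (k - 1)) < s" "s < x k" using dense by blast
  then have "s \<in> elem x k" "s \<in> Oa" using A by auto
  then have "\<not> contC k" using decomposition(2) unfolding contC_def by blast
  have "x k < min b (x (k + 1))" using assms by simp
  then obtain t where t: "x k < t" "t < min b (x (k + 1))" using dense by blast
  then have "t \<in> elem x (k + 1)" "t \<in> Oa" using A by auto
  then have "\<not> contC (k + 1)" using decomposition(2) unfolding contC_def by blast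
  with \<open>\<not> contC k\<close> show False using contA_or_contC contA_left_neighbour assms(1) by blast
qed

section \<open>Residuals of the cells near a node\<close>

lemma node_bounds: "L (e k) \<le> x k" "x k < L (e k + 1)"
  using L_le_x[of "e k" k] L_le_x[of "e k + 1" k] by simp_all

text \<open>The node cuts its cell in the ratio of \<open>\<theta> k\<close> to
  \<open>1 - \<theta> k\<close>, and on each part the stress is the constant given by
  \<open>stress_split\<close>. The bounds on \<open>i\<close> and \<open>r\<close> say that the bond
  covers this cell and stays within the windows.\<close>

lemma bond_error_node:
  assumes k: "x k \<in> Oc" and i: "e k - 1 \<le> i" "i \<le> e k" "e k + 1 \<le> i + int r" "i + int r \<le> e k + 2"
  shows "bond_error i r (e k + 1) = f (real r * secant (L i) (L (i + int r)))
           - \<theta> k * f (real r * secant (L i) (x k)) - (1 - \<theta> k) * f (real r * secant (x k) (L (i + int r)))"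
proof (cases "L i = x k")
  \<comment> \<open>The node is an end point of the bond, so nothing is split. The claimed formula
    also gives 0, because \<open>\<theta> k = 0\<close> and the two remaining terms
    coincide.\<close>
  case True
  then have "L (e k) \<le> L i" using node_bounds(1)[of k] by (simp only:)
  then have ei: "e k = i" using i by simp
  moreover have "\<theta> k = 0" by (simp add: theta_def ei True)
  ultimately have "homogeneous (L i) (L (i + int r))"
    using i True by (intro right_window[OF k]) (simp_all add: ceil_ell_def)
  then have "bond_error i r (e k + 1) = 0" using i by (intro bond_error_homogeneous) auto
  moreover have "\<theta> k = 0" by (simp add: theta_def ei True)
  ultimately show ?thesis using True by simp
next
  case False
  have Li: "L i \<le> L (e k)" "L (e k + 1) \<le> L (i + int r)" using i by simp_all
  then have lt: "L i < x k" "x k < L (i + int r)" using False node_bounds[of k] by linarith+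
  have h: "homogeneous (L i) (x k)" "homogeneous (x k) (L (i + int r))"
    using i by (intro left_window[OF k]; simp) (use i in \<open>intro right_window[OF k]; simp add: ceil_ell_def\<close>)
  note s = stress_split[OF lt _ h not_both_A[OF k lt]]
  have nOa: "x k \<notin> Oa" using k by (simp add: Oa_iff)
  have "((stress i r) has_integral f (real r * secant (L i) (x k)) * (x k - L (e k))
          + f (real r * secant (x k) (L (i + int r))) * (L (e k + 1) - x k)) {L (e k)..L (e k + 1)}"
    by (intro has_integral_combine[of _ "x k"] has_integral_const_interior s nOa)
      (use node_bounds[of k] Li in \<open>simp_all del: L_le L_less\<close>)
  moreover have "x k - L (e k) = \<theta> k / real N" using x_eq[of k] by simp
  moreover have "L (e k + 1) - x k = (1 - \<theta> k) / real N"
    using x_eq[of k] lattice_add[of N "e k" 1] by (simp add: diff_divide_distrib)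
  ultimately have "integral (elem L (e k + 1)) (stress i r)
      = (\<theta> k * f (real r * secant (L i) (x k))
         + (1 - \<theta> k) * f (real r * secant (x k) (L (i + int r)))) / real N"
    by (simp add: integral_unique add_divide_distrib mult.commute)
  then show ?thesis using N_real by (simp add: bond_error_def)
qed

lemma residual_node_1:
  assumes k: "x k \<in> Oc"
  shows "residual (e k + 1) =
      (f (secant (L (e k)) (L (e k + 1))) - \<theta> k * f (secant (L (e k)) (x k))
         - (1 - \<theta> k) * f (secant (x k) (L (e k + 1))))
    + (f (2 * secant (L (e k - 1)) (L (e k + 1))) - \<theta> k * f (2 * secant (L (e k - 1)) (x k))
         - (1 - \<theta> k) * f (2 * secant (x k) (L (e k + 1))))
    + (f (2 * secant (L (e k)) (L (e k + 2))) - \<theta> k * f (2 * secant (L (e k)) (x k))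
         - (1 - \<theta> k) * f (2 * secant (x k) (L (e k + 2))))"
  using bond_error_node[OF k, of "e k" 1] bond_error_node[OF k, of "e k" 2]
    bond_error_node[OF k, of "e k - 1" 2]
  by (simp add: residual_def add.commute[of 1])

text \<open>Of the three bonds over the cell to the left of the node, two end at
  \<open>L (e k)\<close> and lie in the left window; only the bond from \<open>e k - 1\<close> of
  length 2 reaches past the node.\<close>

lemma residual_node_0:
  assumes k: "x k \<in> Oc"
  shows "residual (e k) = f (2 * secant (L (e k - 1)) (L (e k + 1))) - f (2 * secant (L (e k - 1)) (x k))"
proof -
  have "bond_error (e k - 1) 1 (e k) = 0"
    using node_bounds[of k] by (intro bond_error_homogeneous left_window[OF k]) auto
  moreover have "bond_error (e k - 2) 2 (e k) = 0"
    using node_bounds[of k] by (intro bond_error_homogeneous left_window[OF k]) auto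
  moreover have "bond_error (e k - 1) 2 (e k)
      = f (2 * secant (L (e k - 1)) (L (e k + 1))) - f (2 * secant (L (e k - 1)) (x k))"
  proof -
    have "L (e k - 1) < L (e k)" by simp
    then have lt: "L (e k - 1) < x k" "x k < L (e k - 1 + int 2)"
      using node_bounds[of k] by (simp_all del: L_less add: add.commute[of 1])
    have h: "homogeneous (L (e k - 1)) (x k)" "homogeneous (x k) (L (e k - 1 + int 2))"
      by (intro left_window[OF k]; simp) (intro right_window[OF k]; simp add: ceil_ell_def)
    note s = stress_split[OF lt _ h not_both_A[OF k lt]]
    have nOa: "x k \<notin> Oa" using k by (simp add: Oa_iff)
    have "integral (elem L (e k)) (stress (e k - 1) 2)
        = f (real 2 * secant (L (e k - 1)) (x k)) * (L (e k) - L (e k - 1))"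
      using node_bounds[of k] by (intro integral_const_interior s(1) nOa) auto
    then show ?thesis using N_real by (simp add: bond_error_def L_diff add.commute[of 1])
  qed
  ultimately show ?thesis by (simp add: residual_def)
qed

lemma residual_node_2:
  assumes k: "x k \<in> Oc" and hom: "homogeneous (L (e k + 1)) (L (e k + 3))"
  shows "residual (e k + 2) = f (2 * secant (L (e k)) (L (e k + 2))) - f (2 * secant (x k) (L (e k + 2)))"
proof -
  have "bond_error (e k + 1) 1 (e k + 2) = 0"
    using hom by (intro bond_error_homogeneous) (auto elim!: homogeneous_subset)
  moreover have "bond_error (e k + 1) 2 (e k + 2) = 0"
    using hom by (intro bond_error_homogeneous) (auto elim!: homogeneous_subset)
  moreover have "bond_error (e k) 2 (e k + 2)
      = f (2 * secant (L (e k)) (L (e k + 2))) - f (2 * secant (x k) (L (e k + 2)))"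
  proof (cases "\<theta> k = 0")
    case True
    \<comment> \<open>The bond now starts at the node and lies in the right window; both terms on
      the right are the same.\<close>
    then have "x k = L (e k)" "ceil_ell k = e k" using x_eq[of k] by (simp_all add: ceil_ell_def)
    then have "homogeneous (L (e k)) (L (e k + int 2))" by (intro right_window[OF k]) simp_all
    then have "bond_error (e k) 2 (e k + 2) = 0" by (intro bond_error_homogeneous) auto
    then show ?thesis using \<open>x k = L (e k)\<close> by simp
  next
    case False
    have "L (e k + 1) < L (e k + int 2)" by simp
    then have lt: "L (e k) < x k" "x k < L (e k + int 2)"
      using False node_bounds[of k] theta_bounds[of k] theta_pos_iff[of k]
      by (simp_all del: L_less)
    have h: "homogeneous (L (e k)) (x k)" "homogeneous (x k) (L (e k + int 2))"
      by (intro left_window[OF k]; simp) (intro right_window[OF k]; simp add: ceil_ell_def)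
    note s = stress_split[OF lt _ h not_both_A[OF k lt]]
    have nOa: "x k \<notin> Oa" using k by (simp add: Oa_iff)
    have "integral (elem L (e k + 2)) (stress (e k) 2)
        = f (real 2 * secant (x k) (L (e k + int 2))) * (L (e k + 2) - L (e k + 2 - 1))"
      using node_bounds[of k] \<open>L (e k + 1) < L (e k + int 2)\<close>
      by (intro integral_const_interior s(2) nOa) (simp_all add: add.commute[of 1] del: L_less L_le)
    then show ?thesis using N_real by (simp add: bond_error_def L_diff)
  qed
  ultimately show ?thesis by (simp add: residual_def add.commute[of 1])
qed

text \<open>Frontier points of \<open>Oc\<close> are continuum nodes, so the interval stays in one
  region. If this is \<open>Oc\<close>, any node inside would be a continuum node, so the interval
  stays in one element.\<close>

lemma homogeneous_no_node:
  assumes ab: "a < b" and n: "\<And>k. x k \<in> Oc \<Longrightarrow> \<not> (a < x k \<and> x k < b)"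
  shows "homogeneous a b"
proof (cases "{a<..<b} \<subseteq> Oa")
  case False
  have "frontier Oc \<subseteq> Oc" using closed_c by (rule frontier_subset_closed)
  then have "{a<..<b} \<inter> frontier Oc = {}" using frontier_node n by fastforce
  then have Oc: "{a<..<b} \<subseteq> Oc" using interval_in_region False by blast
  obtain t where t: "a < t" "t < b" using ab dense by blast
  obtain k where k: "x (k - 1) \<le> t" "t < x k" using x_elem .
  have a: "x (k - 1) \<le> a" using n[of "k - 1"] Oc k t by (force simp: not_less)
  have b: "b \<le> x k" using n[of k] Oc k t by (force simp: not_less)
  have "\<not> contA k"
  proof
    assume "contA k"
    then have "t \<in> Oa" using a k t by (auto simp: contA_def)
    then show False using Oc t by (auto simp: Oa_iff)
  qed
  then have "contC k" using contA_or_contC by blast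
  then show ?thesis using a b unfolding homogeneous_def by (intro disjI2 exI[of _ k]) auto
qed (simp add: homogeneous_def)

lemma node_in_range:
  assumes "L m < x k" "x k < L n"
  shows "m \<le> e k" "e k < n"
  using assms L_le_x[of m k] L_le_x[of n k] by auto

text \<open>The bonds over cell \<open>l\<close> reach from \<open>L (l - 2)\<close> to
  \<open>L (l + 1)\<close>, so a node in the interior of one of them has \<open>e k\<close> in
  \<open>{l - 2, l - 1, l}\<close>. The value \<open>l - 2\<close> is tried last: absence of nodes
  with the other two values supplies the homogeneity which \<open>residual_node_2\<close> asks
  for.\<close>

lemma residual_cases:
  obtains "residual l = 0" | k where "x k \<in> Oc" "e k = l - 1" | k where "x k \<in> Oc" "e k = l"
  | k where "x k \<in> Oc" "e k = l - 2" "homogeneous (L (l - 1)) (L (l + 1))"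
proof -
  let ?P = "\<lambda>m. \<exists>k. x k \<in> Oc \<and> e k = m"
  have hom: "homogeneous (L (m - 1)) (L (m + 1))" if "\<not> ?P (m - 1)" "\<not> ?P m" for m
  proof (rule homogeneous_no_node)
    fix k assume k: "x k \<in> Oc"
    show "\<not> (L (m - 1) < x k \<and> x k < L (m + 1))"
    proof
      assume "L (m - 1) < x k \<and> x k < L (m + 1)"
      then have "m - 1 \<le> e k" "e k < m + 1" using node_in_range by blast+
      then have "e k = m - 1 \<or> e k = m" by linarith
      then show False using that k by blast
    qed
  qed simp
  consider "?P (l - 1)" | "?P l" | "\<not> ?P (l - 1)" "\<not> ?P l" "?P (l - 2)"
    | "\<not> ?P (l - 1)" "\<not> ?P l" "\<not> ?P (l - 2)" by blast
  then show ?thesis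
  proof cases
    case 4
    then have h: "homogeneous (L (l - 1)) (L (l + 1))" "homogeneous (L (l - 2)) (L l)"
      using hom[of l] hom[of "l - 1"] by simp_all
    have "bond_error (l - 1) 1 l = 0"
      using h(1) by (intro bond_error_homogeneous) (auto elim!: homogeneous_subset)
    moreover have "bond_error (l - 1) 2 l = 0" "bond_error (l - 2) 2 l = 0"
      using h by (auto intro!: bond_error_homogeneous simp: add.commute[of 1])
    ultimately show ?thesis using that(1) by (simp add: residual_def)
  qed (use that hom[of l] in blast)+
qed

text \<open>The slopes on the lattice cells with indices \<open>e k\<close> and \<open>e k + 2\<close>.\<close>

definition left_slope :: "int \<Rightarrow> real" where
  "left_slope k = (if contA k \<and> \<theta> k \<noteq> 0 then G (k - 1) else G k)"

definition right_slope :: "int \<Rightarrow> real" where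
  "right_slope k = (if contA (k + 1) then G (k + 2) else G (k + 1))"

section \<open>Slopes and secants around a node\<close>

lemma lattice_node: "L m \<in> Oa \<Longrightarrow> \<exists>j. x j = L m"
  using lattice_point_node[of m] by (metis rangeE)

lemma node_lattice: "x k \<in> Oa \<Longrightarrow> \<exists>m. x k = L m"
  using node_lattice_point[of k] by (metis rangeE)

text \<open>Nodes in the atomistic region are lattice points, so an earlier next node would be a
  lattice point strictly inside a cell.\<close>

lemma next_node_A:
  assumes "{x j<..<b} \<subseteq> Oa" "L m \<le> b" "L (m - 1) \<le> x j"
  shows "L m \<le> x (j + 1)"
proof (rule ccontr)
  assume n: "\<not> L m \<le> x (j + 1)"
  have lt: "x j < x (j + 1)" by simp
  then have "x (j + 1) \<in> {x j<..<b}" using n assms(2) by simp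
  then obtain i where i: "x (j + 1) = L i" using assms(1) node_lattice by blast
  have "L (m - 1) < L i" "L i < L m" using lt n assms(3) unfolding i by linarith+
  then show False by simp
qed

lemma previous_node_A:
  assumes "{a<..<x j} \<subseteq> Oa" "a \<le> L m" "x j \<le> L (m + 1)"
  shows "x (j - 1) \<le> L m"
proof (rule ccontr)
  assume n: "\<not> x (j - 1) \<le> L m"
  have lt: "x (j - 1) < x j" by simp
  then have "x (j - 1) \<in> {a<..<x j}" using n assms(2) by simp
  then obtain i where i: "x (j - 1) = L i" using assms(1) node_lattice by blast
  have "L m < L i" "L i < L (m + 1)" using lt n assms(3) unfolding i by linarith+
  then show False by simp
qed

text \<open>No distinction on \<open>\<theta> k\<close> appears in the values, unlike in
  \<open>y_left\<close>: \<open>ell\<close> rounds down, so the part of cell \<open>e k + 1\<close>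
  to the right of the node is never empty and always belongs to element
  \<open>k + 1\<close>.\<close>

lemma y_right:
  assumes k: "x k \<in> Oc"
  shows "y (L (e k + 1)) - y (x k) = G (k + 1) * (1 - \<theta> k) / real N"
    and "y (L (e k + 2)) - y (L (e k + 1)) = right_slope k / real N"
proof -
  have len: "L (e k + 1) - x k = (1 - \<theta> k) / real N"
    using x_eq[of k] lattice_add[of N "e k" 1] by (simp add: diff_divide_distrib)
  have len2: "L (e k + 2) - L (e k + 1) = 1 / real N" by (simp add: L_diff)
  have ord: "x k \<le> L (e k + 1)" "L (e k + 1) \<le> L (e k + 2)" "L (e k + 2) \<le> L (ceil_ell k + 2)"
    using node_bounds[of k] by (simp_all add: ceil_ell_def)
  have *: "L (e k + 1) \<le> x (k + 1) \<and> y (L (e k + 2)) - y (L (e k + 1)) = right_slope k / real N"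
  proof (cases "contA (k + 1)")
    case True
    note A = right_window_A[OF True k]
    have 1: "L (e k + 1) \<le> x (k + 1)"
      using ord node_bounds[of k] by (intro next_node_A[OF A]) (simp_all add: ceil_ell_def)
    have "L (e k + 1) \<in> {x k<..<L (ceil_ell k + 2)}" using node_bounds[of k] by (simp add: ceil_ell_def)
    \<comment> \<open>Conversely, atomistic lattice points are nodes; together with the previous
      bound this identifies \<open>x (k + 1)\<close>.\<close>
    then obtain j where j: "x j = L (e k + 1)" using A lattice_node by blast
    then have "x k < x j" using node_bounds[of k] by simp
    then have "x (k + 1) \<le> x j" by simp
    then have "x (k + 1) = L (e k + 1)" using 1 j by simp
    moreover have "{x (k + 1)<..<L (ceil_ell k + 2)} \<subseteq> Oa"
    proof -
      have "x k \<le> x (k + 1)" by simp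
      then have "{x (k + 1)<..<L (ceil_ell k + 2)} \<subseteq> {x k<..<L (ceil_ell k + 2)}" by (auto simp del: x_le)
      then show ?thesis using A by blast
    qed
    from next_node_A[OF this, of "e k + 2"] have "L (e k + 2) \<le> x (k + 1 + 1)"
      using ord 1 by (simp add: add.commute[of 1] add.commute[of 2])
    moreover have "L (e k + 1) \<le> x (k + 2)"
      using 1 x_le[of "k + 1" "k + 2"] by linarith
    ultimately have "y (L (e k + 2)) - y (L (e k + 1)) = G (k + 2) * (L (e k + 2) - L (e k + 1))"
      by (intro y_diff) (simp_all add: add.commute[of 1] add.commute[of 2])
    then show ?thesis using 1 True by (simp add: len2 right_slope_def)
  next
    case False
    then have "contC (k + 1)" using contA_or_contC by blast
    from right_window_C[OF this] have *: "L (e k + 2) \<le> x (k + 1)" using ord by linarith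
    then have le: "L (e k + 1) \<le> x (k + 1)" "x k \<le> L (e k + 2)"
      using ord by linarith+
    with * have "y (L (e k + 2)) - y (L (e k + 1)) = G (k + 1) * (L (e k + 2) - L (e k + 1))"
      using ord(1) by (intro y_diff) simp_all
    then show ?thesis using False le by (simp add: len2 right_slope_def)
  qed
  then show "y (L (e k + 2)) - y (L (e k + 1)) = right_slope k / real N" by blast
  have "y (L (e k + 1)) - y (x k) = G (k + 1) * (L (e k + 1) - x k)"
    using * ord by (intro y_diff) simp_all
  then show "y (L (e k + 1)) - y (x k) = G (k + 1) * (1 - \<theta> k) / real N" by (simp add: len)
qed

lemma y_left:
  assumes k: "x k \<in> Oc"
  shows "y (x k) - y (L (e k)) = G k * \<theta> k / real N"
    and "y (L (e k)) - y (L (e k - 1)) = left_slope k / real N"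
proof -
  have len: "x k - L (e k) = \<theta> k / real N"
    using x_eq[of k] by simp
  have len2: "L (e k) - L (e k - 1) = 1 / real N" by (simp add: L_diff)
  have ord: "L (e k) \<le> x k" "L (e k - 1) \<le> L (e k)" "L (e k - 2) \<le> L (e k - 1)" "x k \<le> L (e k + 1)"
    using node_bounds[of k] by simp_all
  have *: "x (k - 1) \<le> L (e k) \<and> y (L (e k)) - y (L (e k - 1)) = left_slope k / real N"
  proof (cases "contA k")
    case True
    note A = left_window_A[OF True k]
    have 1: "x (k - 1) \<le> L (e k)"
      using ord by (intro previous_node_A[OF A]) simp_all
    show ?thesis
    proof (cases "\<theta> k = 0")
      \<comment> \<open>The node is the right end of cell \<open>e k\<close>, which therefore
        belongs to element \<open>k\<close>.\<close>
      case t: True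
      then have xk: "x k = L (e k)" using x_eq[of k] by simp
      then have "x (k - 1) \<le> L (e k - 1)"
        using ord by (intro previous_node_A[OF A]) simp_all
      then have "y (L (e k)) - y (L (e k - 1)) = G k * (L (e k) - L (e k - 1))"
        using ord 1 by (intro y_diff) (simp_all add: xk)
      then show ?thesis using 1 t by (simp add: len2 left_slope_def)
    next
      \<comment> \<open>Element \<open>k\<close> is only the partial cell between
        \<open>L (e k)\<close> and the node, and the full cell \<open>e k\<close> belongs to element
        \<open>k - 1\<close>.\<close>
      case t: False
      then have lt: "L (e k) < x k" using theta_bounds[of k] theta_pos_iff[of k] by simp
      then have "L (e k) \<in> {L (e k - 2)<..<x k}" by simp
      then obtain j where j: "x j = L (e k)" using A lattice_node by blast
      then have "x j < x k" using lt by simp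
      then have "x j \<le> x (k - 1)" by simp
      then have xk: "x (k - 1) = L (e k)" using 1 j by simp
      have "{L (e k - 2)<..<x (k - 1)} \<subseteq> Oa"
      proof -
        have "x (k - 1) \<le> x k" by simp
        then have "{L (e k - 2)<..<x (k - 1)} \<subseteq> {L (e k - 2)<..<x k}" by (auto simp del: x_le)
        then show ?thesis using A by blast
      qed
      from previous_node_A[OF this, of "e k - 1"] have "x (k - 1 - 1) \<le> L (e k - 1)"
        using ord 1 by simp
      moreover have "x (k - 1 - 1) \<le> L (e k)"
        using x_le[of "k - 1 - 1" "k - 1"] xk by linarith
      ultimately have "y (L (e k)) - y (L (e k - 1)) = G (k - 1) * (L (e k) - L (e k - 1))"
        using xk by (intro y_diff) simp_all
      then show ?thesis using 1 True t by (simp add: len2 left_slope_def)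
    qed
  next
    case False
    then have "contC k" using contA_or_contC by blast
    from left_window_C[OF this] have *: "x (k - 1) \<le> L (e k - 1)" using ord by linarith
    then have le: "x (k - 1) \<le> L (e k)" "L (e k - 1) \<le> x k"
      using ord by linarith+
    with * have "y (L (e k)) - y (L (e k - 1)) = G k * (L (e k) - L (e k - 1))"
      using ord(1) by (intro y_diff) simp_all
    then show ?thesis using False le by (simp add: len2 left_slope_def)
  qed
  then show "y (L (e k)) - y (L (e k - 1)) = left_slope k / real N" by blast
  have "y (x k) - y (L (e k)) = G k * (x k - L (e k))"
    using * ord by (intro y_diff) simp_all
  then show "y (x k) - y (L (e k)) = G k * \<theta> k / real N" by (simp add: len)
qed

lemma secant_add:
  assumes "y b - y a = p / real N" "b - a = q / real N"
  shows "secant a b = p / q"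
  using assms N_real by (simp add: secant_def)

lemma node_secants:
  assumes k: "x k \<in> Oc"
  defines "g \<equiv> G k" and "g1 \<equiv> G (k + 1)" and "gm \<equiv> left_slope k" and "g2 \<equiv> right_slope k"
  shows "secant (L (e k)) (L (e k + 1)) = \<theta> k * g + (1 - \<theta> k) * g1"
    and "2 * secant (L (e k - 1)) (L (e k + 1)) = gm + \<theta> k * g + (1 - \<theta> k) * g1"
    and "2 * secant (L (e k)) (L (e k + 2)) = \<theta> k * g + (1 - \<theta> k) * g1 + g2"
    and "secant (x k) (L (e k + 1)) = g1"
    and "secant (L (e k - 1)) (x k) = (gm + \<theta> k * g) / (1 + \<theta> k)"
    and "secant (x k) (L (e k + 2)) = ((1 - \<theta> k) * g1 + g2) / (2 - \<theta> k)"
    and "\<theta> k * h (secant (L (e k)) (x k)) = \<theta> k * h g"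
proof -
  note yr = y_right[OF k] and yl = y_left[OF k]
  have d: "x k = L (e k) + \<theta> k / real N" "L (e k + 1) = L (e k) + 1 / real N"
    "L (e k + 2) = L (e k) + 2 / real N" "L (e k - 1) = L (e k) - 1 / real N"
    using x_eq[of k] lattice_add[of N "e k" 1] lattice_add[of N "e k" 2] lattice_add[of N "e k" "-1"]
    by simp_all
  note s = diff_divide_distrib add_divide_distrib left_diff_distrib right_diff_distrib mult.commute
  have "secant (L (e k)) (L (e k + 1)) = (\<theta> k * g + (1 - \<theta> k) * g1) / 1"
    by (rule secant_add) (use yr yl d in \<open>simp_all add: g_def g1_def s\<close>)
  then show "secant (L (e k)) (L (e k + 1)) = \<theta> k * g + (1 - \<theta> k) * g1" by simp
  have "secant (L (e k - 1)) (L (e k + 1)) = (gm + \<theta> k * g + (1 - \<theta> k) * g1) / 2"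
    by (rule secant_add) (use yr yl d in \<open>simp_all add: g_def g1_def gm_def s\<close>)
  then show "2 * secant (L (e k - 1)) (L (e k + 1)) = gm + \<theta> k * g + (1 - \<theta> k) * g1" by simp
  have "secant (L (e k)) (L (e k + 2)) = (\<theta> k * g + (1 - \<theta> k) * g1 + g2) / 2"
    by (rule secant_add) (use yr yl d in \<open>simp_all add: g_def g1_def g2_def s\<close>)
  then show "2 * secant (L (e k)) (L (e k + 2)) = \<theta> k * g + (1 - \<theta> k) * g1 + g2" by simp
  have "secant (x k) (L (e k + 1)) = g1 * (1 - \<theta> k) / (1 - \<theta> k)"
    by (rule secant_add) (use yr yl d in \<open>simp_all add: g1_def s\<close>)
  then show "secant (x k) (L (e k + 1)) = g1" using theta_bounds[of k] by simp
  show "secant (L (e k - 1)) (x k) = (gm + \<theta> k * g) / (1 + \<theta> k)"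
    by (rule secant_add) (use yr yl d in \<open>simp_all add: g_def gm_def s\<close>)
  show "secant (x k) (L (e k + 2)) = ((1 - \<theta> k) * g1 + g2) / (2 - \<theta> k)"
    by (rule secant_add) (use yr yl d in \<open>simp_all add: g1_def g2_def s\<close>)
  have "secant (L (e k)) (x k) = g * \<theta> k / \<theta> k"
    by (rule secant_add) (use yl d in \<open>simp_all add: g_def\<close>)
  \<comment> \<open>For \<open>\<theta> k = 0\<close> the secant is the default value 0 of a
    division by zero, not \<open>g\<close>; the factor \<open>\<theta> k\<close> hides this.\<close>
  then show "\<theta> k * h (secant (L (e k)) (x k)) = \<theta> k * h g" by simp
qed

lemma residual_defect:
  assumes k: "x k \<in> Oc" and j: "j \<le> 2" and h: "j = 2 \<Longrightarrow> homogeneous (L (e k + 1)) (L (e k + 3))"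
  shows "residual (e k + int j) = defect f (\<theta> k) (left_slope k) (G k) (G (k + 1)) (right_slope k) j"
proof -
  note s = node_secants[OF k]
  consider "j = 0" | "j = 1" | "j = 2" using j by linarith
  then show ?thesis
  proof cases
    case 1
    then show ?thesis using residual_node_0[OF k] s by (simp add: defect_def)
  next
    case 2
    then show ?thesis
      using residual_node_1[OF k] s(1-6) s(7)[of f] s(7)[of "\<lambda>t. f (2 * t)"] by (simp add: defect_def)
  next
    case 3
    then show ?thesis using residual_node_2[OF k h] s by (simp add: defect_def)
  qed
qed

abbreviation "J \<equiv> jump N x K M La Ra \<phi> y"

lemma jump_defect:
  assumes k: "x k \<in> Oc"
  shows "(J k j)\<^sup>2 = (defect f (\<theta> k) (left_slope k) (G k) (G (k + 1)) (right_slope k) j)\<^sup>2"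
proof -
  note [simp] = is_interface_La is_interface_Ra k
  note t = theta_bounds[of k]
  show ?thesis
  proof (cases "contA (k + 1)")
    case True
    then have "contC k" using contA_left_neighbour k by blast
    \<comment> \<open>Hence \<open>left_slope k\<close> is \<open>G k\<close>, as
      \<open>jump_left\<close> presupposes.\<close>
    then have "\<not> contA k" using not_contA_contC by blast
    then show ?thesis
      using True defect_left[OF t] by (simp add: jump_def Let_def left_slope_def right_slope_def)
  next
    case A: False
    show ?thesis
    proof (cases "contA k")
      case True
      then show ?thesis
        using A defect_right[OF t] by (auto simp: jump_def Let_def left_slope_def right_slope_def)
    next
      case False
      then show ?thesis
        using A defect_inner[OF t] by (simp add: jump_def Let_def left_slope_def right_slope_def)
    qed
  qed
qed

lemma residual_jump:
  "residual l = 0 \<or> (\<exists>k j. x k \<in> Oc \<and> j \<le> 2 \<and> e k + int j = l \<and> (residual l)\<^sup>2 = (J k j)\<^sup>2)"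
proof (rule residual_cases[of l])
  fix k assume k: "x k \<in> Oc" "e k = l - 1"
  then have "residual (e k + int 1) = defect f (\<theta> k) (left_slope k) (G k) (G (k + 1)) (right_slope k) 1"
    by (intro residual_defect) simp_all
  then show ?thesis using k jump_defect[of k 1]
    by (intro disjI2 exI[of _ k] exI[of _ 1]) simp
next
  fix k assume k: "x k \<in> Oc" "e k = l"
  then have "residual (e k + int 0) = defect f (\<theta> k) (left_slope k) (G k) (G (k + 1)) (right_slope k) 0"
    by (intro residual_defect) simp_all
  then show ?thesis using k jump_defect[of k 0]
    by (intro disjI2 exI[of _ k] exI[of _ 0]) simp
next
  fix k assume k: "x k \<in> Oc" "e k = l - 2" and h: "homogeneous (L (l - 1)) (L (l + 1))"
  have "residual (e k + int 2) = defect f (\<theta> k) (left_slope k) (G k) (G (k + 1)) (right_slope k) 2"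
    using k h by (intro residual_defect) (simp_all add: add.commute[of 1])
  then show ?thesis using k jump_defect[of k 2]
    by (intro disjI2 exI[of _ k] exI[of _ 2]) simp
qed simp

section \<open>Comparison with the estimator\<close>

definition jump_sum :: "int \<Rightarrow> real" where
  "jump_sum k = (\<Sum>j\<in>{0..2}. (J k j)\<^sup>2)"

lemma jump_sum_nonneg: "0 \<le> jump_sum k"
  by (simp add: jump_sum_def sum_nonneg)

lemma y_shift_int: "y (t + of_int n) = y t + of_int n * F"
proof -
  have *: "y (t + real m) = y t + real m * F" for t m
  proof (induction m)
    case (Suc m)
    then show ?case using y_shift[of "t + real m"] by (simp add: algebra_simps)
  qed simp
  show ?thesis
  proof (cases "n \<ge> 0")
    case True
    then show ?thesis using *[of t "nat n"] by simp
  next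
    case False
    then show ?thesis using *[of "t + of_int n" "nat (- n)"] by (simp add: algebra_simps)
  qed
qed

lemma slope_shift: "G (k + n * int K) = G k"
proof -
  have "deriv y (t + of_int n) = deriv y t" for t
    using y_shift_int by (rule deriv_shift)
  moreover have "(x (k + n * int K - 1) + x (k + n * int K)) / 2 = (x (k - 1) + x k) / 2 + of_int n"
    using x_shift[of k n] x_shift[of "k - 1" n] by (simp add: algebra_simps add_divide_distrib)
  ultimately show ?thesis by (simp only: slope_def)
qed

lemma e_shift: "e (k + n * int K) = e k + n * int N"
proof -
  have "x (k + n * int K) * real N = x k * real N + of_int (n * int N)"
    by (simp add: x_shift algebra_simps)
  then show ?thesis by (simp only: e_floor floor_add_int)
qed

lemma theta_shift: "\<theta> (k + n * int K) = \<theta> k"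
  by (simp add: theta_def e_shift x_shift lattice_shift[OF N_pos])

lemma jump_shift: "J (k + n * int K) j = J k j"
proof -
  have "G (k + n * int K + 1) = G (k + 1)" "G (k + n * int K + 2) = G (k + 2)"
    "G (k + n * int K - 1) = G (k - 1)"
    using slope_shift[of "k + 1" n] slope_shift[of "k + 2" n] slope_shift[of "k - 1" n]
    by (simp_all add: algebra_simps)
  then show ?thesis
    unfolding jump_def Let_def by (simp add: slope_shift theta_shift is_interface_shift)
qed

lemma jump_sum_shift: "jump_sum (k + n * int K) = jump_sum k"
  by (simp add: jump_sum_def jump_shift)

text \<open>Every nonzero residual is matched with a pair of a node and an offset \<open>j\<close>.
  Several pairs may lead to the same cell, which only enlarges the right-hand side.\<close>

lemma sum_residual_le:
  "(\<Sum>l\<in>{1..int N}. (residual l)\<^sup>2) \<le> (\<Sum>k\<in>{k \<in> {1..int K}. x k \<in> Oc}. jump_sum k)"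
proof -
  let ?s = "{l \<in> {1..int N}. residual l \<noteq> 0}"
  let ?t = "{k \<in> {1..int K}. x k \<in> Oc} \<times> {0..2::nat}"
  \<comment> \<open>Moving the node into the period shifts the cell by a multiple of
    \<open>N\<close>. The reduction is offset by 1 because cells are numbered from 1 to
    \<open>N\<close>.\<close>
  let ?i = "\<lambda>(k, j). (e k + int j - 1) mod int N + 1"
  have "(\<Sum>l\<in>{1..int N}. (residual l)\<^sup>2) = (\<Sum>l\<in>?s. (residual l)\<^sup>2)"
    by (rule sum.mono_neutral_right) auto
  also have "\<dots> \<le> (\<Sum>(k, j)\<in>?t. (J k j)\<^sup>2)"
  proof (rule sum_le_included[where i = ?i])
    have "finite {k \<in> {1..int K}. x k \<in> Oc}" by (rule finite_subset[of _ "{1..int K}"]) auto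
    then show "finite ?t" by simp
    show "finite ?s" by (rule finite_subset[of _ "{1..int N}"]) auto
    show "\<forall>l\<in>?s. \<exists>p\<in>?t. ?i p = l \<and> (residual l)\<^sup>2 \<le> (case p of (k, j) \<Rightarrow> (J k j)\<^sup>2)"
    proof
      fix l assume l: "l \<in> ?s"
      then obtain k j where k: "x k \<in> Oc" "j \<le> 2" "e k + int j = l" "(residual l)\<^sup>2 = (J k j)\<^sup>2"
        using residual_jump[of l] by auto
      obtain n where n: "1 \<le> k + n * int K" "k + n * int K \<le> int K" using shift_to_period[of k] .
      have "e (k + n * int K) + int j - 1 = l - 1 + n * int N" using k(3) by (simp add: e_shift)
      moreover have "(l - 1 + n * int N) mod int N = l - 1" using l by (subst mod_mult_self1) auto
      ultimately have "?i (k + n * int K, j) = l" by (simp only: prod.case)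
      moreover have "(k + n * int K, j) \<in> ?t" using n k(1,2) by (simp add: x_shift Oc_shift)
      ultimately show "\<exists>p\<in>?t. ?i p = l \<and> (residual l)\<^sup>2 \<le> (case p of (k, j) \<Rightarrow> (J k j)\<^sup>2)"
        using k(4) by (intro bexI[of _ "(k + n * int K, j)"]) (simp_all add: jump_shift)
    qed
  qed auto
  also have "\<dots> = (\<Sum>k\<in>{k \<in> {1..int K}. x k \<in> Oc}. jump_sum k)"
    by (simp add: jump_sum_def sum.cartesian_product)
  finally show ?thesis .
qed

lemma index_c_eq: "index_c x K Oc = {k \<in> {1..int K}. contC k}"
proof -
  have "elem x k \<inter> {0..1} \<noteq> {}" "elem x k \<inter> {1<..} = {}" if "1 \<le> k" "k \<le> int K" for k
  proof -
    have "x k \<in> elem x k \<inter> {0..1}" using period_nodes[OF that] by simp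
    then show "elem x k \<inter> {0..1} \<noteq> {}" by blast
    show "elem x k \<inter> {1<..} = {}" using period_nodes[OF that] by auto
  qed
  then show ?thesis by (auto simp: index_c_def contC_def)
qed

text \<open>The share of the jumps at node \<open>k\<close> that goes to one neighbouring element:
  \<open>La\<close> is used for the element on the left of the node, \<open>Ra\<close> for the one
  on the right.\<close>

definition weight :: "(nat \<Rightarrow> int) \<Rightarrow> int \<Rightarrow> real" where
  "weight I k = (if is_interface K M I k then 1 else 1 / 2)"

lemma eta_square:
  "(eta N x K M La Ra \<phi> y k)\<^sup>2
     = (weight La k * jump_sum k + weight Ra (k - 1) * jump_sum (k - 1)) / real N"
proof -
  have "0 \<le> jump_sum k / real N" "0 \<le> jump_sum (k - 1) / real N" using jump_sum_nonneg by simp_all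
  then show ?thesis
    unfolding eta_def Let_def jump_sum_def[symmetric] weight_def
    by (simp add: add_divide_distrib)
qed

text \<open>Between two continuum elements each gets at least one half; an interface has a single
  continuum neighbour, which takes the full weight.\<close>

lemma weight_sum_ge:
  assumes "x k \<in> Oc"
  shows "1 \<le> (if contC k then weight La k else 0) + (if contC (k + 1) then weight Ra k else 0)"
proof -
  consider "contA (k + 1)" "contC k" | "contA k" "contC (k + 1)" | "contC k" "contC (k + 1)"
    using contA_or_contC contA_left_neighbour contA_right_neighbour assms by blast
  then show ?thesis by cases (auto simp: weight_def is_interface_La is_interface_Ra assms)
qed

lemma estimator_ge:
  "(\<Sum>k\<in>{k \<in> {1..int K}. x k \<in> Oc}. jump_sum k) / real N \<le> (\<Sum>k\<in>index_c x K Oc. (eta N x K M La Ra \<phi> y k)\<^sup>2)"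
proof -
  let ?T = "\<lambda>k. (if contC (k + 1) then weight Ra k else 0) * jump_sum k"
  let ?U = "\<lambda>k. (if contC k then weight La k else 0) * jump_sum k"
  \<comment> \<open>\<open>eta\<close> is indexed by elements, the jumps by nodes. The share from
    the left end of an element is reindexed by one, which is harmless by periodicity.\<close>
  have shift: "(\<Sum>k\<in>{1..int K}. ?T (k - 1)) = (\<Sum>k\<in>{1..int K}. ?T k)"
  proof -
    have "contC (int K + 1) = contC 1" "is_interface K M Ra (int K) = is_interface K M Ra 0"
      "jump_sum (int K) = jump_sum 0"
      using contC_shift[of 1 1] is_interface_shift[of Ra 0 1] jump_sum_shift[of 0 1]
      by (simp_all add: add.commute)
    then have "?T (int K) = ?T 0" by (simp add: weight_def)
    then show ?thesis by (rule sum_shift_period)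
  qed
  have "(\<Sum>k\<in>{k \<in> {1..int K}. x k \<in> Oc}. jump_sum k)
      \<le> (\<Sum>k\<in>{k \<in> {1..int K}. x k \<in> Oc}. ?U k + ?T k)"
  proof (rule sum_mono)
    fix k assume "k \<in> {k \<in> {1..int K}. x k \<in> Oc}"
    then have "1 \<le> (if contC k then weight La k else 0) + (if contC (k + 1) then weight Ra k else 0)"
      by (intro weight_sum_ge) simp
    from mult_right_mono[OF this jump_sum_nonneg[of k]] show "jump_sum k \<le> ?U k + ?T k"
      by (simp add: distrib_right)
  qed
  also have "\<dots> \<le> (\<Sum>k\<in>{1..int K}. ?U k + ?T k)"
    by (rule sum_mono2) (auto simp: weight_def jump_sum_nonneg)
  also have "\<dots> = (\<Sum>k\<in>{1..int K}. ?U k) + (\<Sum>k\<in>{1..int K}. ?T (k - 1))"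
    by (simp only: sum.distrib shift)
  also have "\<dots> = (\<Sum>k\<in>{1..int K}. if contC k then weight La k * jump_sum k + weight Ra (k - 1) * jump_sum (k - 1) else 0)"
    by (subst sum.distrib[symmetric], rule sum.cong) auto
  also have "\<dots> = (\<Sum>k\<in>index_c x K Oc. weight La k * jump_sum k + weight Ra (k - 1) * jump_sum (k - 1))"
    unfolding index_c_eq by (simp only: sum.inter_filter[OF finite_atLeastAtMost_int])
  also have "\<dots> = real N * (\<Sum>k\<in>index_c x K Oc. (eta N x K M La Ra \<phi> y k)\<^sup>2)"
    unfolding eta_square sum_divide_distrib[symmetric] using N_real by simp
  finally show ?thesis using N_real by (simp add: divide_le_eq mult.commute)
qed

lemma residual_estimator:
  "sqrt ((\<Sum>l\<in>{1..int N}. (residual l)\<^sup>2) / real N) \<le> estimator N Oc x K M La Ra \<phi> y"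
  unfolding estimator_def
  using divide_right_mono[OF sum_residual_le, of "real N"] estimator_ge
  by (intro real_sqrt_le_mono) simp

section \<open>The consistency error as a sum of residuals\<close>

lemma contA_interior: "contA k \<Longrightarrow> x (k - 1) < t \<Longrightarrow> t < x k \<Longrightarrow> t \<in> Oa"
  unfolding contA_def by (meson greaterThanLessThan_iff subset_iff)

lemma contC_interior: "contC k \<Longrightarrow> x (k - 1) < t \<Longrightarrow> t < x k \<Longrightarrow> t \<in> Oc"
  unfolding contC_def by (meson atLeastAtMost_iff less_imp_le subset_iff)

text \<open>If \<open>L m\<close> is in \<open>Oa\<close>, it is a node by
  \<open>lattice_point_node\<close>. Otherwise it lies in \<open>Oc\<close> while \<open>Oa\<close>
  begins right behind it, and no element changes region in its interior.\<close>

lemma subset_Oa_left_node: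
  assumes "{L m<..<b} \<subseteq> Oa" "L m < b"
  obtains k where "x k = L m"
proof (cases "L m \<in> Oa")
  case True
  then show ?thesis using lattice_node that by blast
next
  case False
  obtain k where k: "x (k - 1) \<le> L m" "L m < x k" using x_elem .
  have "x (k - 1) = L m"
  proof (rule ccontr)
    assume "x (k - 1) \<noteq> L m"
    with k have lt: "x (k - 1) < L m" by simp
    then have "contC k" using False k contA_interior contA_or_contC by blast
    have "L m < min b (x k)" using assms k by simp
    then obtain t where t: "L m < t" "t < min b (x k)" using dense by blast
    then have "t \<in> Oc" using \<open>contC k\<close> lt by (intro contC_interior) auto
    moreover have "t \<in> Oa" using t assms(1) by auto
    ultimately show False by (simp add: Oa_iff)
  qed
  then show ?thesis using that by blast
qed

lemma subset_Oa_right_node: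
  assumes "{a<..<L m} \<subseteq> Oa" "a < L m"
  obtains k where "x k = L m"
proof (cases "L m \<in> Oa")
  case True
  then show ?thesis using lattice_node that by blast
next
  case False
  obtain k where k: "x (k - 1) \<le> L m" "L m < x k" using x_elem .
  have "x (k - 1) = L m"
  proof (rule ccontr)
    assume "x (k - 1) \<noteq> L m"
    with k have lt: "x (k - 1) < L m" by simp
    then have "contC k" using False k contA_interior contA_or_contC by blast
    have "max a (x (k - 1)) < L m" using assms lt by simp
    then obtain t where t: "max a (x (k - 1)) < t" "t < L m" using dense by blast
    then have "t \<in> Oc" using \<open>contC k\<close> k by (intro contC_interior) auto
    moreover have "t \<in> Oa" using t assms(1) by auto
    ultimately show False by (simp add: Oa_iff)
  qed
  then show ?thesis using that by blast
qed

lemma homogeneous_Oa: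
  assumes "homogeneous a b"
  obtains "{a<..<b} \<subseteq> Oa" | "{a<..<b} \<inter> Oa = {}"
proof -
  have "{a<..<b} \<inter> Oa = {}" if "contC k" "{a..b} \<subseteq> elem x k" for k
  proof -
    have "{a<..<b} \<subseteq> {a..b}" by auto
    then show ?thesis using that decomposition(2) unfolding contC_def by blast
  qed
  then show ?thesis using assms that unfolding homogeneous_def by blast
qed

text \<open>Interpolation on the mesh preserves differences of \<open>v\<close> only between nodes,
  so the atomistic part of a bond has to end at nodes. A bond with a continuum node inside is cut
  there into two homogeneous halves, at most one of which is atomistic.\<close>

lemma bnd_Int_Oa:
  assumes r: "r \<in> {1, 2}"
  obtains "bnd i r \<inter> Oa = {}" | a b where "x a < x b" "bnd i r \<inter> Oa = {x a<..<x b}"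
proof -
  have lt: "L i < L (i + int r)" using r by auto
  show ?thesis
  proof (cases "\<exists>k. x k \<in> Oc \<and> L i < x k \<and> x k < L (i + int r)")
    case False
    then have "homogeneous (L i) (L (i + int r))"
      using lt by (intro homogeneous_no_node) blast+
    then show ?thesis
    proof (cases rule: homogeneous_Oa)
      case 1
      obtain a where a: "x a = L i" using subset_Oa_left_node[OF 1 lt] .
      obtain b where b: "x b = L (i + int r)" using subset_Oa_right_node[OF 1 lt] .
      have "bnd i r \<inter> Oa = {x a<..<x b}" using 1 unfolding a b bnd_def by blast
      moreover have "x a < x b" using lt by (simp only: a b)
      ultimately show ?thesis using that(2) by blast
    qed (use that(1) in \<open>simp add: bnd_def\<close>)
  next
    case True
    then obtain k where k: "x k \<in> Oc" "L i < x k" "x k < L (i + int r)" by blast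
    have ei: "i \<le> e k" "e k < i + int r" using node_in_range[OF k(2,3)] .
    have "ceil_ell k = e k \<or> ceil_ell k = e k + 1" by (simp add: ceil_ell_def)
    moreover have "i + int r \<le> ceil_ell k + 2"
    proof (cases "\<theta> k = 0")
      case True
      then have "x k = L (e k)" using x_eq[of k] by simp
      then have "i < e k" using k(2) by simp
      then show ?thesis using r by (auto simp: ceil_ell_def)
    next
      case False
      then show ?thesis using ei r by (auto simp: ceil_ell_def)
    qed
    ultimately have h: "homogeneous (L i) (x k)" "homogeneous (x k) (L (i + int r))"
      using ei r by (intro left_window[OF k(1)]; auto) (use ei r \<open>i + int r \<le> ceil_ell k + 2\<close> in \<open>intro right_window[OF k(1)]; auto\<close>)
    have un: "bnd i r \<inter> Oa = ({L i<..<x k} \<inter> Oa) \<union> ({x k<..<L (i + int r)} \<inter> Oa)"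
    proof -
      have "bnd i r = {L i<..<x k} \<union> {x k} \<union> {x k<..<L (i + int r)}" using k by (auto simp: bnd_def)
      then show ?thesis using k(1) decomposition(2) by blast
    qed
    from h(1) show ?thesis
    proof (cases rule: homogeneous_Oa)
      case 1
      then have "\<not> {x k<..<L (i + int r)} \<subseteq> Oa" using not_both_A[OF k] by blast
      then have "{x k<..<L (i + int r)} \<inter> Oa = {}" using h(2) homogeneous_Oa by metis
      moreover obtain a where a: "x a = L i" using subset_Oa_left_node[OF 1 k(2)] .
      ultimately have "bnd i r \<inter> Oa = {x a<..<x k}" using 1 un by auto
      moreover have "x a < x k" using k(2) by (simp only: a)
      ultimately show ?thesis using that(2) by blast
    next
      case 2
      note left = this
      from h(2) show ?thesis
      proof (cases rule: homogeneous_Oa)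
        case 1
        obtain b where b: "x b = L (i + int r)" using subset_Oa_right_node[OF 1 k(3)] .
        have "bnd i r \<inter> Oa = {x k<..<x b}" using 1 un left b by auto
        moreover have "x k < x b" using k(3) by (simp only: b)
        ultimately show ?thesis using that(2) by blast
      next
        case 2
        then show ?thesis using left un that(1) by simp
      qed
    qed
  qed
qed

text \<open>The stress is split because its parts are tested differently: \<open>stress_a\<close>
  depends on the bond and is handled bond by bond, while \<open>stress_c\<close> is periodic and the
  same for all bonds of equal length, so that it can be integrated over the mesh.\<close>

definition stress_a :: "int \<Rightarrow> nat \<Rightarrow> real \<Rightarrow> real" where
  "stress_a i r t = (if t \<in> Oa then f (real r * diffq (bnd i r \<inter> Oa) y) else 0)"

definition stress_c :: "nat \<Rightarrow> real \<Rightarrow> real" where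
  "stress_c r t = (if t \<in> Oc then f (real r * deriv y t) else 0)"

lemma stress_sum: "stress i r t = stress_a i r t + stress_c r t"
  by (simp add: stress_def stress_a_def stress_c_def Oa_iff)

lemma stress_a_const:
  obtains c where "\<And>t. t \<in> {x (k - 1)<..<x k} \<Longrightarrow> stress_a i r t = c"
proof (cases "contA k")
  case True
  then show ?thesis
    using contA_interior by (intro that[of "f (real r * diffq (bnd i r \<inter> Oa) y)"]) (auto simp: stress_a_def)
next
  case False
  then have "contC k" using contA_or_contC by blast
  then show ?thesis
    using contC_interior by (intro that[of 0]) (auto simp: stress_a_def Oa_iff)
qed

lemma stress_c_const:
  obtains c where "\<And>t. t \<in> {x (k - 1)<..<x k} \<Longrightarrow> stress_c r t = c"
proof (cases "contA k")
  case True
  then have "t \<notin> Oc" if "t \<in> {x (k - 1)<..<x k}" for t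
    using contA_interior[OF True, of t] that by (simp add: Oa_iff)
  then show ?thesis by (intro that[of 0]) (simp add: stress_c_def)
next
  case False
  then have "contC k" using contA_or_contC by blast
  then show ?thesis
    using contC_interior y_deriv by (intro that[of "f (real r * G k)"]) (auto simp: stress_c_def)
qed

lemma stress_a_integrable: "locally_integrable (stress_a i r)"
proof (rule locally_integrable_mesh)
  fix k
  obtain c where "\<And>t. t \<in> {x (k - 1)<..<x k} \<Longrightarrow> stress_a i r t = c" using stress_a_const by blast
  then have "(stress_a i r has_integral c * (x k - x (k - 1))) (elem x k)"
    by (intro has_integral_const_interior) auto
  then show "stress_a i r integrable_on elem x k" by blast
qed

lemma stress_c_integrable: "locally_integrable (stress_c r)"
proof (rule locally_integrable_mesh)
  fix k
  obtain c where "\<And>t. t \<in> {x (k - 1)<..<x k} \<Longrightarrow> stress_c r t = c" using stress_c_const by blast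
  then have "(stress_c r has_integral c * (x k - x (k - 1))) (elem x k)"
    by (intro has_integral_const_interior) auto
  then show "stress_c r integrable_on elem x k" by blast
qed

lemma stress_c_shift: "stress_c r (t + 1) = stress_c r t"
proof -
  have "deriv y (t + 1) = deriv y t" using y_shift by (rule deriv_shift)
  then show ?thesis by (simp add: stress_c_def periodic_regions)
qed

section \<open>Integrals over a period, by cells and by elements\<close>

lemma bond_eq: "bond N i r = bnd (int i) r"
  by (simp add: bond_def bnd_def lattice_def)

lemma L_0: "L 0 = 0" and L_N: "L (int N) = 1"
  using N_real by (simp_all add: lattice_def)

lemma L_shift: "L (l + int N) = L l + 1"
  using lattice_shift[OF N_pos, of l 1] by simp

lemma integral_L_sum:
  assumes "locally_integrable h"
  shows "integral {0..1} h = (\<Sum>l\<in>{1..int N}. integral (elem L l) h)"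
  using integral_sum_partition[OF assms strict_mono_lattice[OF N_pos], of N]
  by (simp only: L_0 L_N)

lemma integral_mesh_sum:
  assumes "locally_integrable h" "\<And>t. h (t + 1) = h t"
  shows "integral {0..1} h = (\<Sum>k\<in>{1..int K}. integral (elem x k) h)"
proof -
  have "x (int K) = x 0 + 1" using periodic_x[of 0] by simp
  moreover have "integral {x 0..x 0 + 1} h = integral {0..1} h"
    using assms leftmost period_nodes[of "int K"] K_pos \<open>x (int K) = x 0 + 1\<close>
    by (intro integral_full_period) auto
  ultimately show ?thesis
    using integral_sum_partition[OF assms(1) strict_mono_x, of K] by simp
qed

lemma integral_two_cells:
  assumes "locally_integrable h"
  shows "integral {L i..L (i + 2)} h = integral (elem L (i + 1)) h + integral (elem L (i + 2)) h"
  using assms Henstock_Kurzweil_Integration.integral_combine[of "L i" "L (i + 1)" "L (i + 2)" h]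
  by (simp add: locally_integrable_def add.commute[of 1])

text \<open>This serves the last bond of length 2, which sticks out into cell \<open>N + 1\<close>:
  there, and on cell 1, no atomistic stress occurs.\<close>

lemma boundary_cells:
  assumes "t \<in> {L 0<..<L 1}"
  shows "t \<in> Oc" "t + 1 \<in> Oc"
proof -
  obtain \<delta> where d: "\<delta> > 2 / real N" "{0<..<\<delta>} \<union> {1 - \<delta><..<1} \<subseteq> Oc"
    using boundary_layer by blast
  have "1 / real N < \<delta>" using d(1) N_real by (simp add: field_simps)
  then have "t \<in> {0<..<\<delta>}" using assms by (auto simp: lattice_def)
  then show "t \<in> Oc" using d(2) by blast
  then show "t + 1 \<in> Oc" by (simp add: periodic_regions)
qed

end

section \<open>The error tested with a fixed function\<close>

locale qc_test = qc_deformation +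
  fixes v :: "real \<Rightarrow> real"
  assumes v_space: "v \<in> space_U N"
begin

abbreviation "d \<equiv> slope (lattice N) v"
abbreviation "w \<equiv> J_U x K v"

lemma v_P1: "v \<in> P1 L" and v_cont: "continuous_on UNIV v" and v_shift: "v (t + 1) = v t"
  using v_space by (auto simp: space_U_def periodic_P1_def)

lemmas v_diff = P1_diff[OF v_P1 strict_mono_lattice[OF N_pos]]
lemmas v_deriv = P1_deriv[OF v_P1 strict_mono_lattice[OF N_pos]]
lemmas v_FTC = lattice_P1_integral_deriv[OF N_pos v_P1 v_cont]

lemma deriv_v_integrable: "deriv v integrable_on {a..b}"
  using v_FTC[of a b] by (cases "a \<le> b") auto

lemma deriv_v_shift: "deriv v (t + 1) = deriv v t"
  by (rule deriv_shift[of v 1 0]) (simp add: v_shift)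

lemma d_shift: "d (l + int N) = d l"
proof -
  have "(L (l + int N - 1) + L (l + int N)) / 2 = (L (l - 1) + L l) / 2 + 1"
    using L_shift[of l] L_shift[of "l - 1"] by (simp add: algebra_simps)
  then show ?thesis using deriv_v_shift by (simp only: slope_def)
qed

lemma v_cell: "v (L l) - v (L (l - 1)) = d l / real N"
  using v_diff[of "L (l - 1)" l "L l"] by (simp add: L_diff)

lemma w_node: "w (x b) - w (x a) = v (x b) - v (x a)"
  by (simp add: J_U_def interp_node[OF strict_mono_x])

lemma w_deriv_const:
  "t \<in> {x (k - 1)<..<x k} \<Longrightarrow> deriv w t = (v (x k) - v (x (k - 1))) / (x k - x (k - 1))"
  unfolding J_U_def by (rule interp_deriv[OF strict_mono_x]) auto

lemma w_deriv_shift: "deriv w (t + 1) = deriv w t"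
proof (rule deriv_shift[of w 1 0])
  fix t
  obtain k where k: "x (k - 1) \<le> t" "t < x k" using x_elem .
  have s: "x (k + int K) = x k + 1" "x (k + int K - 1) = x (k - 1) + 1"
    using periodic_x[of k] periodic_x[of "k - 1"] by (simp_all add: algebra_simps)
  have "interp x v (t + 1) = interp x v t"
    using interp_elem[OF strict_mono_x, of "k + int K" "t + 1" v] interp_elem[OF strict_mono_x k, of v] k
    by (simp add: s v_shift)
  then show "w (t + 1) = w t + 0" by (simp add: J_U_def)
qed

lemma integral_cell_deriv:
  "integral (elem L l) (\<lambda>t. h t * deriv v t) = d l * integral (elem L l) h"
  using integral_mult_const_interior[of "L (l - 1)" "L l" "deriv v" "d l" h] v_deriv
  by (simp add: mult.commute)

lemma mesh_const_mult_integrable: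
  assumes "\<And>k. \<exists>c. \<forall>t\<in>{x (k - 1)<..<x k}. h t = c"
  shows "locally_integrable (\<lambda>t. h t * deriv v t)" "locally_integrable (\<lambda>t. h t * deriv w t)"
proof -
  show "locally_integrable (\<lambda>t. h t * deriv v t)"
    using assms deriv_v_integrable
    by (intro locally_integrable_mesh) (metis integrable_const_interior)
  show "locally_integrable (\<lambda>t. h t * deriv w t)"
  proof (rule locally_integrable_mesh)
    fix k
    have "(deriv w has_integral (v (x k) - v (x (k - 1))) / (x k - x (k - 1)) * (x k - x (k - 1))) (elem x k)"
      by (intro has_integral_const_interior w_deriv_const) auto
    then have "deriv w integrable_on elem x k" by blast
    then show "(\<lambda>t. h t * deriv w t) integrable_on elem x k"
      using assms[of k] by (metis integrable_const_interior)
  qed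
qed

lemma stress_a_deriv_integrable: "locally_integrable (\<lambda>t. stress_a i r t * deriv v t)"
  using stress_a_const by (intro mesh_const_mult_integrable) metis

lemma stress_c_deriv_integrable: "locally_integrable (\<lambda>t. stress_c r t * deriv v t)"
   "locally_integrable (\<lambda>t. stress_c r t * deriv w t)"
  using stress_c_const by (intro mesh_const_mult_integrable; metis)+

text \<open>An element need not be a union of lattice cells. So \<open>deriv w\<close> is first
  replaced by \<open>deriv v\<close> element by element, using equal means, and the resulting
  integral is cut afresh along the lattice.\<close>

lemma integral_stress_c:
  "integral {0..1} (\<lambda>t. stress_c r t * deriv w t) = (\<Sum>l\<in>{1..int N}. d l * integral (elem L l) (stress_c r))"
proof -
  have "integral (elem x k) (\<lambda>t. stress_c r t * deriv w t)
      = integral (elem x k) (\<lambda>t. stress_c r t * deriv v t)" for k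
  proof -
    obtain c where c: "\<And>t. t \<in> {x (k - 1)<..<x k} \<Longrightarrow> stress_c r t = c" using stress_c_const by blast
    have "integral (elem x k) (deriv w) = (v (x k) - v (x (k - 1))) / (x k - x (k - 1)) * (x k - x (k - 1))"
      by (intro integral_const_interior w_deriv_const) auto
    also have "\<dots> = v (x k) - v (x (k - 1))"
      using x_less[of "k - 1" k] by (simp del: x_less)
    also have "\<dots> = integral (elem x k) (deriv v)"
      using v_FTC[of "x (k - 1)" "x k"] by (simp add: integral_unique)
    finally show ?thesis
      using integral_mult_const_interior[of "x (k - 1)" "x k" "stress_c r" c, OF c] by simp
  qed
  then have "integral {0..1} (\<lambda>t. stress_c r t * deriv w t) = integral {0..1} (\<lambda>t. stress_c r t * deriv v t)"
    using stress_c_deriv_integrable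
    by (simp add: integral_mesh_sum stress_c_shift deriv_v_shift w_deriv_shift)
  also have "\<dots> = (\<Sum>l\<in>{1..int N}. d l * integral (elem L l) (stress_c r))"
    using stress_c_deriv_integrable by (simp add: integral_L_sum integral_cell_deriv)
  finally show ?thesis .
qed

lemma bond_Oc:
  assumes "r > 0"
  shows "1 / real r * integral (bond N i r \<inter> Oc) (\<lambda>t. f (real r * deriv y t) * (real r * deriv w t))
    = integral {L (int i)..L (int i + int r)} (\<lambda>t. stress_c r t * deriv w t)"
proof -
  have "integral (bond N i r \<inter> Oc) (\<lambda>t. f (real r * deriv y t) * (real r * deriv w t))
      = integral (Oc \<inter> {L (int i)<..<L (int i + int r)}) (\<lambda>t. real r * (f (real r * deriv y t) * deriv w t))"
    by (simp add: bond_eq bnd_def Int_commute mult.left_commute)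
  also have "\<dots> = integral {L (int i)<..<L (int i + int r)} (\<lambda>t. real r * (stress_c r t * deriv w t))"
  proof -
    have "(\<lambda>t. real r * (stress_c r t * deriv w t))
        = (\<lambda>t. if t \<in> Oc then real r * (f (real r * deriv y t) * deriv w t) else 0)"
      by (auto simp: stress_c_def)
    then show ?thesis by (simp only: Henstock_Kurzweil_Integration.integral_restrict_Int)
  qed
  also have "\<dots> = real r * integral {L (int i)..L (int i + int r)} (\<lambda>t. stress_c r t * deriv w t)"
    by (simp add: integral_open_interval_real)
  finally show ?thesis using assms by simp
qed

text \<open>The test function changes from \<open>w\<close> to \<open>v\<close> here. The factor in
  front of \<open>deriv v\<close> is constant, so only the difference between two nodes
  enters.\<close>

lemma bond_Oa:
  assumes r: "r \<in> {1, 2}"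
  shows "measure lborel (bond N i r \<inter> Oa) * f (real r * diffq (bond N i r \<inter> Oa) y) * diffq (bond N i r \<inter> Oa) w
    = integral {L (int i)..L (int i + int r)} (\<lambda>t. stress_a (int i) r t * deriv v t)"
proof -
  define c where "c = f (real r * diffq (bnd (int i) r \<inter> Oa) y)"
  have "integral {L (int i)..L (int i + int r)} (\<lambda>t. stress_a (int i) r t * deriv v t)
      = integral {L (int i)<..<L (int i + int r)} (\<lambda>t. if t \<in> Oa then c * deriv v t else 0)"
    unfolding integral_open_interval_real[symmetric]
    by (rule arg_cong[of _ _ "integral _"]) (auto simp: stress_a_def c_def)
  also have "\<dots> = integral (bnd (int i) r \<inter> Oa) (\<lambda>t. c * deriv v t)"
    by (simp add: Henstock_Kurzweil_Integration.integral_restrict_Int bnd_def Int_commute)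
  also have "\<dots> = measure lborel (bnd (int i) r \<inter> Oa) * c * diffq (bnd (int i) r \<inter> Oa) w"
  proof (rule bnd_Int_Oa[OF r, of "int i"])
    fix a b assume ab: "x a < x b" "bnd (int i) r \<inter> Oa = {x a<..<x b}"
    have "integral {x a<..<x b} (\<lambda>t. c * deriv v t) = c * (v (x b) - v (x a))"
      using v_FTC[of "x a" "x b"] ab(1)
      by (simp add: integral_open_interval_real[symmetric] integral_unique)
    also have "\<dots> = (x b - x a) * c * diffq {x a<..<x b} w"
      using ab(1) by (simp add: diffq_interval w_node del: x_less)
    finally show ?thesis using ab(1) unfolding ab(2) by simp
  qed simp
  finally show ?thesis by (simp add: c_def bond_eq)
qed

lemma dEqc_eq:
  "dEqc N Oa Oc \<phi> y w = (\<Sum>l\<in>{1..int N}. d l *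
     (integral (elem L l) (stress (l - 1) 1) + integral (elem L l) (stress (l - 1) 2)
       + integral (elem L l) (stress (l - 2) 2)))"
proof -
  define A where "A l i r = d l * integral (elem L l) (stress_a i r)" for l i r
  \<comment> \<open>\<open>C\<close> still contains \<open>deriv w\<close>: only its sum over a
    period, not a single term, can be expressed through \<open>v\<close>.\<close>
  define C where "C l r = integral (elem L l) (\<lambda>t. stress_c r t * deriv w t)" for l r
  have C_sum: "(\<Sum>l\<in>{1..int N}. C l r) = (\<Sum>l\<in>{1..int N}. d l * integral (elem L l) (stress_c r))" for r
    using integral_L_sum[OF stress_c_deriv_integrable(2)] integral_stress_c by (simp add: C_def)
  have C_per: "C (int N + 1) r = C 1 r" for r
  proof -
    have "elem L (int N + 1) = {L 0 + 1..L 1 + 1}"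
      using L_shift[of 0] L_shift[of 1] by (simp add: add.commute)
    moreover have "integral {L 0 + 1..L 1 + 1} (\<lambda>t. stress_c r t * deriv w t)
        = integral {L 0..L 1} (\<lambda>t. stress_c r t * deriv w t)"
      using stress_c_deriv_integrable(2)
      by (intro integral_shift_periodic) (auto simp: locally_integrable_def stress_c_shift w_deriv_shift)
    ultimately show ?thesis by (simp add: C_def)
  qed
  \<comment> \<open>Reindexing exchanges cell \<open>N + 1\<close> of the bond from
    \<open>N - 1\<close> for cell 1 of the bond from -1. Both contributions vanish in the continuum
    layer.\<close>
  have A_zero: "A (int N + 1) (int N - 1) 2 = 0" "A 1 (- 1) 2 = 0"
  proof -
    have "elem L (int N + 1) = {L 0 + 1..L 1 + 1}"
      using L_shift[of 0] L_shift[of 1] by (simp add: add.commute)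
    moreover have "integral {L 0 + 1..L 1 + 1} (stress_a (int N - 1) 2) = 0 * (L 1 + 1 - (L 0 + 1))"
    proof (rule integral_const_interior)
      fix t assume "t \<in> {L 0 + 1<..<L 1 + 1}"
      then show "stress_a (int N - 1) 2 t = 0" using boundary_cells(2)[of "t - 1"] by (simp add: stress_a_def Oa_iff)
    qed simp
    ultimately show "A (int N + 1) (int N - 1) 2 = 0" by (simp add: A_def)
    have "integral {L 0..L 1} (stress_a (- 1) 2) = 0 * (L 1 - L 0)"
      by (rule integral_const_interior) (use boundary_cells(1) in \<open>simp_all add: stress_a_def Oa_iff\<close>)
    then show "A 1 (- 1) 2 = 0" by (simp add: A_def)
  qed
  have a: "measure lborel (bond N i 1 \<inter> Oa) * f (real 1 * diffq (bond N i 1 \<inter> Oa) y) * diffq (bond N i 1 \<inter> Oa) w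
        = A (int i + 1) (int i) 1"
      "measure lborel (bond N i 2 \<inter> Oa) * f (real 2 * diffq (bond N i 2 \<inter> Oa) y) * diffq (bond N i 2 \<inter> Oa) w
        = A (int i + 1) (int i) 2 + A (int i + 2) (int i) 2" for i
  proof -
    have "integral {L (int i)..L (int i + 1)} (\<lambda>t. stress_a (int i) 1 t * deriv v t) = A (int i + 1) (int i) 1"
      using integral_cell_deriv[of "int i + 1" "stress_a (int i) 1"] by (simp add: A_def)
    then show "measure lborel (bond N i 1 \<inter> Oa) * f (real 1 * diffq (bond N i 1 \<inter> Oa) y) * diffq (bond N i 1 \<inter> Oa) w
        = A (int i + 1) (int i) 1"
      using bond_Oa[of 1 i] by simp
    have "integral {L (int i)..L (int i + 2)} (\<lambda>t. stress_a (int i) 2 t * deriv v t)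
        = A (int i + 1) (int i) 2 + A (int i + 2) (int i) 2"
      unfolding A_def integral_two_cells[OF stress_a_deriv_integrable] by (simp only: integral_cell_deriv)
    then show "measure lborel (bond N i 2 \<inter> Oa) * f (real 2 * diffq (bond N i 2 \<inter> Oa) y) * diffq (bond N i 2 \<inter> Oa) w
        = A (int i + 1) (int i) 2 + A (int i + 2) (int i) 2"
      using bond_Oa[of 2 i] by simp
  qed
  have c: "1 / real 1 * integral (bond N i 1 \<inter> Oc) (\<lambda>t. f (real 1 * deriv y t) * (real 1 * deriv w t))
        = C (int i + 1) 1"
      "1 / real 2 * integral (bond N i 2 \<inter> Oc) (\<lambda>t. f (real 2 * deriv y t) * (real 2 * deriv w t))
        = C (int i + 1) 2 + C (int i + 2) 2" for i
    using bond_Oc[of 1 i] bond_Oc[of 2 i] integral_two_cells[OF stress_c_deriv_integrable(2)]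
    by (simp_all add: C_def)
  have "dEqc N Oa Oc \<phi> y w
      = (\<Sum>i\<in>{0..<N}. A (int i + 1) (int i) 1 + (A (int i + 1) (int i) 2 + A (int i + 2) (int i) 2))
      + (\<Sum>i\<in>{0..<N}. C (int i + 1) 1 + (C (int i + 1) 2 + C (int i + 2) 2))"
    unfolding dEqc_def using a c by (simp del: of_nat_numeral of_nat_1)
  \<comment> \<open>The factor 2 arises because every cell is covered by two bonds of length 2, and
    \<open>C\<close> does not depend on the bond.\<close>
  also have "\<dots> = (\<Sum>l\<in>{1..int N}. A l (l - 1) 1) + (\<Sum>l\<in>{1..int N}. A l (l - 1) 2) + (\<Sum>l\<in>{1..int N}. A l (l - 2) 2)
      + (\<Sum>l\<in>{1..int N}. C l 1) + 2 * (\<Sum>l\<in>{1..int N}. C l 2)"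
    using sum_int_shift[of "\<lambda>l. A l (l - 1) 1" N] sum_int_shift[of "\<lambda>l. A l (l - 1) 2" N]
      sum_int_shift_period[of "\<lambda>l. A l (l - 2) 2" N] A_zero
      sum_int_shift[of "\<lambda>l. C l 1" N] sum_int_shift[of "\<lambda>l. C l 2" N]
      sum_int_shift_period[of "\<lambda>l. C l 2" N] C_per
    by (simp add: sum.distrib)
  also have "\<dots> = (\<Sum>l\<in>{1..int N}. d l *
     (integral (elem L l) (stress (l - 1) 1) + integral (elem L l) (stress (l - 1) 2)
       + integral (elem L l) (stress (l - 2) 2)))"
  proof -
    have "integral (elem L l) (stress i r) = integral (elem L l) (stress_a i r) + integral (elem L l) (stress_c r)"
      for i r l
      using stress_a_integrable stress_c_integrable
      unfolding stress_sum by (intro integral_add) (auto simp: locally_integrable_def)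
    then show ?thesis
      by (simp add: C_sum A_def sum.distrib distrib_left mult.left_commute[of _ 2] sum_distrib_left[symmetric])
  qed
  finally show ?thesis .
qed

lemma dEa_eq:
  "dEa N \<phi> (J_Uqc N F y) v = (\<Sum>l\<in>{1..int N}. d l *
     (f (secant (L (l - 1)) (L l)) + f (2 * secant (L (l - 1)) (L (l + 1)))
       + f (2 * secant (L (l - 2)) (L l)))) / real N"
proof -
  define A where "A i r = f (real r * secant (L i) (L (i + int r)))" for i r
  have J: "J_Uqc N F y (L j) - J_Uqc N F y (L i) = y (L j) - y (L i)" for i j
    by (simp add: J_Uqc_def Let_def interp_node[OF strict_mono_lattice[OF N_pos]])
  have "diffq (bond N i r) (J_Uqc N F y) = secant (L (int i)) (L (int i + int r))" if "r > 0" for i r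
    using that by (simp add: bond_eq bnd_def diffq_interval J secant_def)
  moreover have "real 1 * diffq (bond N i 1) v = d (int i + 1)" for i
    using v_cell[of "int i + 1"] N_real by (simp add: bond_eq bnd_def diffq_interval L_diff)
  moreover have "real 2 * diffq (bond N i 2) v = d (int i + 1) + d (int i + 2)" for i
  proof -
    have "v (L (int i + 2)) - v (L (int i)) = (d (int i + 1) + d (int i + 2)) / real N"
      using v_cell[of "int i + 1"] v_cell[of "int i + 2"] by (simp add: add_divide_distrib add.commute[of 1])
    then show ?thesis using N_real by (simp add: bond_eq bnd_def diffq_interval L_diff)
  qed
  ultimately have "dEa N \<phi> (J_Uqc N F y) v
      = (\<Sum>i\<in>{0..<N}. A (int i) 1 * d (int i + 1) + A (int i) 2 * (d (int i + 1) + d (int i + 2))) / real N"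
    unfolding dEa_def A_def by (simp del: of_nat_numeral of_nat_1)
  also have "(\<Sum>i\<in>{0..<N}. A (int i) 1 * d (int i + 1) + A (int i) 2 * (d (int i + 1) + d (int i + 2)))
      = (\<Sum>l\<in>{1..int N}. d l * A (l - 1) 1) + (\<Sum>l\<in>{1..int N}. d l * A (l - 1) 2) + (\<Sum>l\<in>{1..int N}. d l * A (l - 2) 2)"
  proof -
    \<comment> \<open>In the atomistic energy the bond that leaves the period does contribute; it is
      a translate of the bond from -1, and the increment \<open>F\<close> of \<open>y\<close>
      cancels in the secant.\<close>
    have "A (int N - 1) 2 = A (- 1) 2"
    proof -
      have "L (int N - 1) = L (- 1) + of_int 1" "L (int N - 1 + 2) = L (- 1 + 2) + of_int 1"
        using L_shift[of "- 1"] L_shift[of 1] by (simp_all add: add.commute)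
      then have "secant (L (int N - 1)) (L (int N - 1 + 2)) = secant (L (- 1)) (L (- 1 + 2))"
        unfolding secant_def by (simp only: y_shift_int) simp
      then show ?thesis by (simp add: A_def)
    qed
    then show ?thesis
      using sum_int_shift[of "\<lambda>l. d l * A (l - 1) 1" N] sum_int_shift[of "\<lambda>l. d l * A (l - 1) 2" N]
        sum_int_shift_period[of "\<lambda>l. d l * A (l - 2) 2" N] d_shift[of 1]
      by (simp add: sum.distrib distrib_left mult.commute add.commute)
  qed
  finally show ?thesis
    by (simp add: A_def sum.distrib distrib_left add.commute[of 1])
qed

lemma consistency_error:
  "dEa N \<phi> (J_Uqc N F y) v - dEqc N Oa Oc \<phi> y w = (\<Sum>l\<in>{1..int N}. d l * residual l) / real N"
proof -
  have "d l * residual l = d l * (f (secant (L (l - 1)) (L l)) + f (2 * secant (L (l - 1)) (L (l + 1)))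
       + f (2 * secant (L (l - 2)) (L l)))
      - real N * (d l * (integral (elem L l) (stress (l - 1) 1) + integral (elem L l) (stress (l - 1) 2)
       + integral (elem L l) (stress (l - 2) 2)))" for l
    by (simp add: residual_def bond_error_def algebra_simps)
  then show ?thesis
    using N_real by (simp add: dEa_eq dEqc_eq sum_subtractf diff_divide_distrib sum_distrib_left[symmetric])
qed

lemma L2_norm_deriv: "L2_norm_01 (deriv v) = sqrt ((\<Sum>l\<in>{1..int N}. (d l)\<^sup>2) / real N)"
proof -
  have cell: "((\<lambda>t. (deriv v t)\<^sup>2) has_integral (d l)\<^sup>2 * (L l - L (l - 1))) (elem L l)" for l
    using v_deriv by (intro has_integral_const_interior) auto
  then have "locally_integrable (\<lambda>t. (deriv v t)\<^sup>2)"
    by (intro locally_integrable_partition[OF strict_mono_lattice[OF N_pos] lattice_unbounded[OF N_pos]]) blast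
  then have "integral {0..1} (\<lambda>t. (deriv v t)\<^sup>2) = (\<Sum>l\<in>{1..int N}. (d l)\<^sup>2 * (L l - L (l - 1)))"
    by (simp only: integral_L_sum integral_unique[OF cell])
  then show ?thesis by (simp add: L2_norm_01_def L_diff sum_divide_distrib)
qed

lemma consistency_error_le:
  assumes "L2_norm_01 (deriv v) = 1"
  shows "dEa N \<phi> (J_Uqc N F y) v - dEqc N Oa Oc \<phi> y w \<le> estimator N Oc x K M La Ra \<phi> y"
proof -
  \<comment> \<open>The normalisation of \<open>v\<close> thus cancels one of the two factors
    \<open>1 / real N\<close> left by Cauchy-Schwarz.\<close>
  have d: "(\<Sum>l\<in>{1..int N}. (d l)\<^sup>2) = real N"
    using assms N_real by (simp add: L2_norm_deriv)
  have "((\<Sum>l\<in>{1..int N}. d l * residual l) / real N)\<^sup>2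
      \<le> (\<Sum>l\<in>{1..int N}. (d l)\<^sup>2) * (\<Sum>l\<in>{1..int N}. (residual l)\<^sup>2) / (real N)\<^sup>2"
    unfolding power_divide by (intro divide_right_mono Cauchy_Schwarz_ineq_sum) simp
  also have "\<dots> = (\<Sum>l\<in>{1..int N}. (residual l)\<^sup>2) / real N"
    unfolding d using N_real by (simp add: power2_eq_square)
  finally have "(\<Sum>l\<in>{1..int N}. d l * residual l) / real N
      \<le> sqrt ((\<Sum>l\<in>{1..int N}. (residual l)\<^sup>2) / real N)"
    by (rule real_le_rsqrt)
  then show ?thesis using residual_estimator by (simp add: consistency_error)
qed

end

theorem theorem1:
  fixes N K M :: nat and F :: real and \<phi> y :: "real \<Rightarrow> real"
    and Oa Oc :: "real set" and x :: "int \<Rightarrow> real" and La Ra :: "nat \<Rightarrow> int"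
  assumes "qc_mesh N Oa Oc x K M La Ra"
    and "F > 0"
    and "LJ_potential \<phi>"
    and "y \<in> space_Yqc F x"
    and "\<And>t. t \<notin> range x \<Longrightarrow> deriv y t > 0"
  shows "dual_norm N (\<lambda>v. dEa N \<phi> (J_Uqc N F y) v - dEqc N Oa Oc \<phi> y (J_U x K v))
           \<le> ereal (estimator N Oc x K M La Ra \<phi> y)"
  unfolding dual_norm_def
proof (rule SUP_least)
  fix v assume v: "v \<in> {v \<in> space_U N. L2_norm_01 (deriv v) = 1}"
  interpret qc_mesh N Oa Oc x K M La Ra by (rule assms(1))
  interpret qc_test N Oa Oc x K M La Ra \<phi> y F v
    using v assms(4) by unfold_locales auto
  show "ereal (dEa N \<phi> (J_Uqc N F y) v - dEqc N Oa Oc \<phi> y (J_U x K v))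
      \<le> ereal (estimator N Oc x K M La Ra \<phi> y)"
    using consistency_error_le v by simp
qed

end
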